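(* Let $\mathcal{M}\subseteq\mathbb{R}^{m\times n}$ be a linear subspace, and let $X_*\in\mathcal{B}$ have rank exactly $1$. Assume $T_{X_*}\mathcal{R}_1\cap T_{X_*}\mathcal{B}=\{0\}$. Let $0<\delta<1$ and $0\le\tau_{tol}<1$ be fixed. Then for $X\in\mathcal{B}$ close enough to $X_*$ the Phase I iterate $X_{\mathrm{new}}^{\mathrm{I}}$ is uniquely defined and (for $X\neq X_*$) $$\frac{\|X_{\mathrm{new}}^{\mathrm{I}}-X_*\|_F}{\|X-X_*\|_F}\le\cos\theta+O(\|X-X_*\|_F^2),$$ where $\theta\in(0,\frac{\pi}{2}]$ is the subspace angle between $T_{X_*}\mathcal{B}$ and $T_{X_*}\mathcal{R}_1$, defined by $\cos\theta=\max\frac{|\langle X,Y\rangle_F|}{\|X\|_F\|Y\|_F}$ over nonzero $X\in T_{X_*}\mathcal{B}$, $Y\in T_{X_*}\mathcal{R}_1$. As a consequence, the iterates obtained by repeatedly applying the Phase I step are uniquely defined and converge to $X_*$ at a linear rate for starting values in $\mathcal{B}$ close enough to $X_*$. In fact, there is a neighborhood of $X_*$ such that for all $X\in\mathcal{B}$ in it $$X_{\mathrm{new}}^{\mathrm{I}}=\frac{\mathcal{P}_{\mathcal{M}}(\mathcal{T}_1(X))}{\|\mathcal{P}_{\mathcal{M}}(\mathcal{T}_1(X))\|_F},$$ that is, the Phase I step and the Phase II step (with rank $1$) produce the same iterates.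
   Context: $\langle\cdot,\cdot\rangle_F$ and $\|\cdot\|_F$ are the Frobenius inner product and norm on $\mathbb{R}^{m\times n}$. $\mathcal{P}_{\mathcal{M}}$ is the orthogonal projection (with respect to $\langle\cdot,\cdot\rangle_F$) onto $\mathcal{M}$. $\mathcal{B}=\{X\in\mathcal{M}:\|X\|_F=1\}$ and $\mathcal{R}_1=\{X\in\mathbb{R}^{m\times n}:\operatorname{rank}(X)\le1\}$. For $X=U\Sigma V^T$ an SVD with singular values $\sigma_1\ge\sigma_2\ge\dots\ge0$: the truncation operator is $\mathcal{T}_s(X)=U\operatorname{diag}(\sigma_1,\dots,\sigma_s,0,\dots,0)V^T$, and the shrinkage (soft thresholding) operator is $\mathcal{S}_\tau(X)=U\operatorname{diag}(\max(\sigma_i-\tau,0))_iV^T$. Phase I step with parameters $\delta,\tau_{tol}$, applied to $X\in\mathcal{B}$: let $s$ be the number of singular values of $X$ (counted with multiplicity) that are $>\tau_{tol}$; set $\hat X=\mathcal{T}_s(X)/\|\mathcal{T}_s(X)\|_F$; set $\tau=\delta/\sqrt{s}$; set $Y=\mathcal{S}_\tau(\hat X)$; set $X_{\mathrm{new}}^{\mathrm{I}}=\mathcal{P}_{\mathcal{M}}(Y)/\|\mathcal{P}_{\mathcal{M}}(Y)\|_F$. Phase II step with rank $1$: $X\mapsto\mathcal{P}_{\mathcal{M}}(\mathcal{T}_1(X))/\|\mathcal{P}_{\mathcal{M}}(\mathcal{T}_1(X))\|_F$. "Uniquely defined" means independent of the choice of SVD and with no division by zero. $T_{X_*}\mathcal{B}$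 is the orthogonal complement of $X_*$ within $\mathcal{M}$. If $X_*=\sigma_*u_*v_*^T$ with unit vectors $u_*,v_*$ and $\sigma_*>0$, then $T_{X_*}\mathcal{R}_1=\{u_*y^T+xv_*^T:x\in\mathbb{R}^m,\ y\in\mathbb{R}^n\}$ is the tangent space at $X_*$ to the manifold of rank-one matrices. The $O(\cdot)$ is for $X\to X_*$ in $\mathcal{B}$ with constant possibly depending on $X_*$, $\mathcal{M}$. A maximum over an empty set (the case $T_{X_*}\mathcal{B}=\{0\}$) is read as $0$. Linear rate means that there is $q<1$ such that $\|X_{k+1}-X_*\|_F\le q\|X_k-X_*\|_F$ for all $k$, where $X_k$ are the iterates. *)

theory Defs
  imports "HOL-Analysis.Analysis"
begin

text \<open>
  Real \<open>m \<times> n\<close> matrices are elements of \<^typ>\<open>real^'n^'m\<close>. The library's inner product and norm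
  on this type are the sum over all entries, that is, the Frobenius inner product and norm.
\<close>

definition outer :: "real^'m \<Rightarrow> real^'n \<Rightarrow> real^'n^'m" where
  "outer u v = (\<chi> i j. u $ i * v $ j)"

definition orth_proj :: "('a::euclidean_space) set \<Rightarrow> 'a \<Rightarrow> 'a" where
  "orth_proj M X = (THE P. P \<in> M \<and> (\<forall>Z\<in>M. orthogonal (X - P) Z))"

lemma orth_proj_unique_exists:
  fixes M :: "('a::euclidean_space) set"
  assumes "subspace M"
  shows "\<exists>!P. P \<in> M \<and> (\<forall>Z\<in>M. orthogonal (X - P) Z)"
proof -
  have sp: "span M = M"
    using assms by (simp add: span_eq_iff)
  obtain y z where yz: "y \<in> M" "\<And>w. w \<in> M \<Longrightarrow> orthogonal z w" "X = y + z"
    using orthogonal_subspace_decomp_exists[of M X] sp by metis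
  show ?thesis
  proof (rule ex1I[of _ y])
    show "y \<in> M \<and> (\<forall>Z\<in>M. orthogonal (X - y) Z)"
      using yz by simp
  next
    fix P assume P: "P \<in> M \<and> (\<forall>Z\<in>M. orthogonal (X - P) Z)"
    then have "P - y \<in> M"
      using assms yz(1) by (simp add: subspace_diff)
    then have "(X - y) \<bullet> (P - y) = 0" "(X - P) \<bullet> (P - y) = 0"
      using yz P by (auto simp: orthogonal_def)
    then have "(P - y) \<bullet> (P - y) = 0"
      by (simp add: inner_diff_left)
    then show "P = y"
      by simp
  qed
qed

text \<open>
  Singular values and singular vectors are indexed from \<open>0\<close> to \<open>p - 1\<close>, where \<open>p = min m n\<close>;
  values of the index functions beyond that range are irrelevant. \<open>diag_compose U d V\<close> is
  \<open>U diag(d) V^T\<close>, where \<open>U i\<close> and \<open>V i\<close> are the columns of the two outer factors.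
\<close>

definition svd_size :: "(real^'n^'m) itself \<Rightarrow> nat" where
  "svd_size _ = min CARD('m) CARD('n)"

definition diag_compose ::
    "(nat \<Rightarrow> real^'m) \<Rightarrow> (nat \<Rightarrow> real) \<Rightarrow> (nat \<Rightarrow> real^'n) \<Rightarrow> real^'n^'m" where
  "diag_compose U d V = (\<Sum>i<svd_size TYPE(real^'n^'m). d i *\<^sub>R outer (U i) (V i))"

definition orthonormal_upto :: "nat \<Rightarrow> (nat \<Rightarrow> 'a::real_inner) \<Rightarrow> bool" where
  "orthonormal_upto p U \<longleftrightarrow> (\<forall>i<p. \<forall>j<p. U i \<bullet> U j = (if i = j then 1 else 0))"

definition is_svd ::
    "real^'n^'m \<Rightarrow> (nat \<Rightarrow> real^'m) \<Rightarrow> (nat \<Rightarrow> real) \<Rightarrow> (nat \<Rightarrow> real^'n) \<Rightarrow> bool" where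
  "is_svd X U \<sigma> V \<longleftrightarrow>
     (let p = svd_size TYPE(real^'n^'m) in
        orthonormal_upto p U \<and> orthonormal_upto p V \<and>
        (\<forall>i<p. 0 \<le> \<sigma> i) \<and> (\<forall>i j. i \<le> j \<and> j < p \<longrightarrow> \<sigma> j \<le> \<sigma> i) \<and>
        X = diag_compose U \<sigma> V)"

definition svd_trunc ::
    "nat \<Rightarrow> (nat \<Rightarrow> real^'m) \<Rightarrow> (nat \<Rightarrow> real) \<Rightarrow> (nat \<Rightarrow> real^'n) \<Rightarrow> real^'n^'m" where
  "svd_trunc s U \<sigma> V = diag_compose U (\<lambda>i. if i < s then \<sigma> i else 0) V"

definition svd_shrink ::
    "real \<Rightarrow> (nat \<Rightarrow> real^'m) \<Rightarrow> (nat \<Rightarrow> real) \<Rightarrow> (nat \<Rightarrow> real^'n) \<Rightarrow> real^'n^'m" where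
  "svd_shrink \<tau> U \<sigma> V = diag_compose U (\<lambda>i. max (\<sigma> i - \<tau>) 0) V"

text \<open>
  The two steps are first introduced as relations, ranging over all choices of the SVDs involved.
  \<open>phaseI_run M \<delta> tol X s T Y\<close>: for some choice of SVDs, \<open>s\<close> is the number of singular values
  above \<open>tol\<close>, \<open>T\<close> the truncation of \<open>X\<close>, and \<open>Y\<close> the shrinkage of the normalized \<open>T\<close>.
  Since division by zero yields zero here, a step counts as well-defined only if all
  denominators are nonzero for every choice and the result is the same for every choice.
\<close>

definition phaseI_run ::
    "real \<Rightarrow> real \<Rightarrow> real^'n^'m \<Rightarrow> nat \<Rightarrow> real^'n^'m \<Rightarrow> real^'n^'m \<Rightarrow> bool" where
  "phaseI_run \<delta> tol X s T Y \<longleftrightarrow>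
     (\<exists>U \<sigma> V U' \<sigma>' V'.
        is_svd X U \<sigma> V \<and>
        s = card {i. i < svd_size TYPE(real^'n^'m) \<and> \<sigma> i > tol} \<and>
        T = svd_trunc s U \<sigma> V \<and>
        is_svd (T /\<^sub>R norm T) U' \<sigma>' V' \<and>
        Y = svd_shrink (\<delta> / sqrt (real s)) U' \<sigma>' V')"

definition phaseI_result ::
    "(real^'n^'m) set \<Rightarrow> real \<Rightarrow> real \<Rightarrow> real^'n^'m \<Rightarrow> real^'n^'m \<Rightarrow> bool" where
  "phaseI_result M \<delta> tol X Z \<longleftrightarrow>
     (\<exists>s T Y. phaseI_run \<delta> tol X s T Y \<and> Z = orth_proj M Y /\<^sub>R norm (orth_proj M Y))"

definition phaseI_well_defined ::
    "(real^'n^'m) set \<Rightarrow> real \<Rightarrow> real \<Rightarrow> real^'n^'m \<Rightarrow> bool" where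
  "phaseI_well_defined M \<delta> tol X \<longleftrightarrow>
     (\<forall>s T Y. phaseI_run \<delta> tol X s T Y \<longrightarrow> T \<noteq> 0 \<and> s \<noteq> 0 \<and> orth_proj M Y \<noteq> 0) \<and>
     (\<exists>!Z. phaseI_result M \<delta> tol X Z)"

definition phaseI_step ::
    "(real^'n^'m) set \<Rightarrow> real \<Rightarrow> real \<Rightarrow> real^'n^'m \<Rightarrow> real^'n^'m" where
  "phaseI_step M \<delta> tol X = (THE Z. phaseI_result M \<delta> tol X Z)"

definition phaseII_result ::
    "(real^'n^'m) set \<Rightarrow> nat \<Rightarrow> real^'n^'m \<Rightarrow> real^'n^'m \<Rightarrow> bool" where
  "phaseII_result M r X Z \<longleftrightarrow>
     (\<exists>U \<sigma> V. is_svd X U \<sigma> V \<and>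
        Z = orth_proj M (svd_trunc r U \<sigma> V) /\<^sub>R norm (orth_proj M (svd_trunc r U \<sigma> V)))"

definition phaseII_well_defined :: "(real^'n^'m) set \<Rightarrow> nat \<Rightarrow> real^'n^'m \<Rightarrow> bool" where
  "phaseII_well_defined M r X \<longleftrightarrow>
     (\<forall>U \<sigma> V. is_svd X U \<sigma> V \<longrightarrow> orth_proj M (svd_trunc r U \<sigma> V) \<noteq> 0) \<and>
     (\<exists>!Z. phaseII_result M r X Z)"

definition phaseII_step :: "(real^'n^'m) set \<Rightarrow> nat \<Rightarrow> real^'n^'m \<Rightarrow> real^'n^'m" where
  "phaseII_step M r X = (THE Z. phaseII_result M r X Z)"

definition unit_sphere :: "('a::real_normed_vector) set \<Rightarrow> 'a set" where
  "unit_sphere M = {X \<in> M. norm X = 1}"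

definition tangent_sphere :: "('a::euclidean_space) set \<Rightarrow> 'a \<Rightarrow> 'a set" where
  "tangent_sphere M X = M \<inter> orthogonal_comp {X}"

text \<open>
  Meaningful only for rank-one \<open>X\<close> (empty otherwise). The unit vectors \<open>u\<close>, \<open>v\<close> are determined by
  \<open>X\<close> up to a common sign, so the set does not depend on the representation of \<open>X\<close>.
\<close>

definition tangent_rank_one :: "real^'n^'m \<Rightarrow> (real^'n^'m) set" where
  "tangent_rank_one X =
     {outer u y + outer x v | u v x y.
        norm u = 1 \<and> norm v = 1 \<and> (\<exists>\<sigma>>0. X = \<sigma> *\<^sub>R outer u v)}"

lemma outer_cancel:
  fixes u a :: "real^'m" and v b :: "real^'n"
  assumes n: "norm u = 1" "norm v = 1" "norm a = 1" "norm b = 1"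
    and "0 < \<sigma>" "0 < \<rho>" and eq: "\<sigma> *\<^sub>R outer u v = \<rho> *\<^sub>R outer a b"
  shows "\<exists>c. c * c = 1 \<and> a = c *\<^sub>R u \<and> b = c *\<^sub>R v"
proof -
  have uv: "u \<bullet> u = 1" "v \<bullet> v = 1" "a \<bullet> a = 1" "b \<bullet> b = 1"
    using n by (simp_all add: norm_eq_sqrt_inner)
  have ent: "\<sigma> * (u $ i * v $ j) = \<rho> * (a $ i * b $ j)" for i j
    using arg_cong[OF eq, of "\<lambda>A. A $ i $ j"] by (simp add: outer_def)
  have right: "\<sigma> * (u $ i * (v \<bullet> w)) = \<rho> * (a $ i * (b \<bullet> w))" for i w
  proof -
    have "\<sigma> * (u $ i * (v \<bullet> w)) = (\<Sum>j\<in>UNIV. \<sigma> * (u $ i * v $ j) * w $ j)"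
      by (simp add: inner_vec_def sum_distrib_left mult.assoc)
    also have "\<dots> = \<rho> * (a $ i * (b \<bullet> w))"
      by (simp add: ent) (simp add: inner_vec_def sum_distrib_left mult.assoc)
    finally show ?thesis .
  qed
  have left: "\<sigma> * ((u \<bullet> w) * v $ j) = \<rho> * ((a \<bullet> w) * b $ j)" for j w
  proof -
    have "\<sigma> * ((u \<bullet> w) * v $ j) = (\<Sum>i\<in>UNIV. \<sigma> * (u $ i * v $ j) * w $ i)"
      by (simp add: inner_vec_def sum_distrib_left sum_distrib_right mult_ac)
    also have "\<dots> = \<rho> * ((a \<bullet> w) * b $ j)"
      by (simp add: ent) (simp add: inner_vec_def sum_distrib_left sum_distrib_right mult_ac)
    finally show ?thesis .
  qed
  define c where "c = \<sigma> * (v \<bullet> b) / \<rho>"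
  define d where "d = \<sigma> * (u \<bullet> a) / \<rho>"
  have a: "a = c *\<^sub>R u"
    using right[of _ b] \<open>0 < \<rho>\<close> by (simp add: vec_eq_iff c_def uv field_simps)
  have b: "b = d *\<^sub>R v"
    using left[of a] \<open>0 < \<rho>\<close> by (simp add: vec_eq_iff d_def uv field_simps)
  have cc: "c * c = 1" and dd: "d * d = 1"
    using uv(3,4) unfolding a b by (simp_all add: uv)
  have "u \<noteq> 0"
    using n by auto
  then obtain i where "u $ i \<noteq> 0"
    by (auto simp: vec_eq_iff)
  moreover have "\<sigma> * u $ i = \<rho> * (c * d) * u $ i"
    using right[of i v] unfolding a b by (simp add: uv mult_ac)
  ultimately have "\<rho> * (c * d) = \<sigma>"
    by simp
  then have "0 < c * d"
    using assms by (metis zero_less_mult_pos)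
  moreover have "(c - d) * (c + d) = 0"
    using cc dd by (simp add: algebra_simps)
  ultimately have "c = d"
    using cc by (auto simp: add_eq_0_iff2)
  then show ?thesis
    using a b cc by blast
qed

lemma tangent_rank_one_eq:
  fixes u :: "real^'m" and v :: "real^'n"
  assumes "norm u = 1" "norm v = 1" "0 < \<sigma>"
  shows "tangent_rank_one (\<sigma> *\<^sub>R outer u v) = {outer u y + outer x v | x y. True}"
proof -
  have scale: "outer (c *\<^sub>R w) z = outer w (c *\<^sub>R z)" for c and w :: "real^'m" and z :: "real^'n"
    by (simp add: outer_def vec_eq_iff)
  show ?thesis
    unfolding tangent_rank_one_def
  proof (intro equalityI subsetI)
    fix A assume "A \<in> {outer a y + outer x b | a b x y. norm a = 1 \<and> norm b = 1 \<and>
                       (\<exists>\<rho>>0. \<sigma> *\<^sub>R outer u v = \<rho> *\<^sub>R outer a b)}"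
    then obtain a b x y \<rho> where A: "A = outer a y + outer x b" "norm a = 1" "norm b = 1"
      "0 < \<rho>" "\<sigma> *\<^sub>R outer u v = \<rho> *\<^sub>R outer a b"
      by auto
    then obtain c where "a = c *\<^sub>R u" "b = c *\<^sub>R v"
      using outer_cancel assms by metis
    then have "A = outer u (c *\<^sub>R y) + outer (c *\<^sub>R x) v"
      using A(1) scale by metis
    then show "A \<in> {outer u y + outer x v | x y. True}"
      by auto
  qed (use assms in blast)
qed

text \<open>Cosine of the subspace angle as an attained maximum, read as \<open>0\<close> over the empty set.\<close>

definition is_subspace_angle :: "real \<Rightarrow> ('a::real_inner) set \<Rightarrow> 'a set \<Rightarrow> bool" where
  "is_subspace_angle \<theta> S T \<longleftrightarrow>
     0 \<le> \<theta> \<and> \<theta> \<le> pi / 2 \<and>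
     (let C = {\<bar>X \<bullet> Y\<bar> / (norm X * norm Y) | X Y. X \<in> S \<and> X \<noteq> 0 \<and> Y \<in> T \<and> Y \<noteq> 0}
      in if C = {} then cos \<theta> = 0 else cos \<theta> \<in> C \<and> (\<forall>c\<in>C. c \<le> cos \<theta>))"

end

theory Submission
  imports Defs
begin

text \<open>
  Write \<open>X\<^sub>* = u v^T\<close>, \<open>e = \<parallel>X - X\<^sub>*\<parallel>\<close>, \<open>c = cos \<theta>\<close> and \<open>T\<close> for the leading rank-one term of an SVD of \<open>X\<close>.
  Since \<open>\<parallel>X\<parallel> = 1\<close> and \<open>\<sigma>\<^sub>1 \<ge> \<langle>X, X\<^sub>*\<rangle> = 1 - e^2/2\<close>, all further singular values are at most \<open>e\<close>. Hence \<open>T\<close>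
  is unique, the threshold \<open>\<delta>/\<surd>s\<close> of Phase I removes everything but \<open>T\<close>, and Phase I and Phase II agree,
  because the normalization makes the size of the surviving singular value irrelevant.

  In the direction tangent to the sphere, the linearization of \<open>X \<mapsto> P\<^sub>M T\<close> at \<open>X\<^sub>*\<close> is a product
  of two orthogonal projections restricted to a subspace, so its norm is at most \<open>c^2\<close> rather than \<open>c\<close>.
  With \<open>k\<close> the component of \<open>T\<close> in the tangent space of the rank-one matrices orthogonal to \<open>X\<^sub>*\<close>, the
  remaining parts of \<open>T\<close> and \<open>X\<close> contribute only \<open>O(\<parallel>k\<parallel>^2)\<close> and \<open>O(e \<parallel>k\<parallel>)\<close>. This gives the
  factor \<open>c (c + O(e))\<close>, which is at most \<open>c\<close> near \<open>X\<^sub>*\<close>, also if \<open>c = 0\<close>. So the estimate holds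
  with error constant \<open>0\<close>.
\<close>

section \<open>Outer products and the Frobenius inner product\<close>

lemma inner_outer_outer [simp]: "outer a b \<bullet> outer c d = (a \<bullet> c) * (b \<bullet> d)"
  unfolding outer_def inner_vec_def sum_product by (simp add: mult_ac)

lemma norm_outer [simp]: "norm (outer a b) = norm a * norm b"
  by (simp add: norm_eq_sqrt_inner real_sqrt_mult)

interpretation outer: bounded_bilinear "outer :: real^'m \<Rightarrow> real^'n \<Rightarrow> real^'n^'m"
  by unfold_locales
    (simp_all, auto simp: outer_def vec_eq_iff algebra_simps intro!: exI[of _ 1])

lemma inner_outer: "A \<bullet> outer x y = x \<bullet> (A *v y)"
  by (simp add: outer_def inner_vec_def matrix_vector_mult_def sum_distrib_left mult_ac)

lemma inner_outer': "A \<bullet> outer x y = (x v* A) \<bullet> y"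
  by (simp add: inner_outer dot_lmul_matrix)

lemma inner_outer_le: "A \<bullet> outer x y \<le> norm A * norm x * norm y"
  using norm_cauchy_schwarz[of A "outer x y"] by (simp add: mult.assoc)

text \<open>Testing with \<open>x = A *v y\<close> turns the bound into |A y|^2 <= 0, so a one-sided
  inequality suffices.\<close>

lemma eq_zero_if_inner_outer:
  fixes A :: "real^'n^'m"
  assumes "\<And>x y. A \<bullet> outer x y \<le> 0"
  shows "A = 0"
proof -
  have "A *v y = 0" for y
    using assms[of "A *v y" y] inner_ge_zero[of "A *v y"] by (simp add: inner_outer)
  then show ?thesis
    using matrix_eq[of A 0] by simp
qed

section \<open>Maximizing a bilinear form over unit vectors\<close>

text \<open>Equality case of Cauchy-Schwarz: |w - s v|^2 = |w|^2 - s^2 <= 0.\<close>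

lemma inner_eq_if_extremal:
  fixes w v :: "'a::real_inner"
  assumes "norm v = 1" "w \<bullet> v = s" "norm w \<le> s"
  shows "w = s *\<^sub>R v"
proof -
  have "w \<bullet> w \<le> s * s"
    using power_mono[OF assms(3), of 2] by (simp add: dot_square_norm power2_eq_square)
  moreover have "v \<bullet> v = 1" using assms by (simp add: norm_eq_sqrt_inner)
  ultimately have "(w - s *\<^sub>R v) \<bullet> (w - s *\<^sub>R v) \<le> 0"
    using assms by (simp add: algebra_simps inner_commute)
  then show ?thesis
    using inner_ge_zero[of "w - s *\<^sub>R v"] by simp
qed

lemma norm_le_if_inner_le:
  fixes w :: "'a::real_inner"
  assumes "0 \<le> s" "\<And>y. w \<bullet> y \<le> s * norm y"
  shows "norm w \<le> s"
proof (cases "w = 0")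
  case False
  then show ?thesis
    using assms(2)[of w] by (simp add: power2_norm_eq_inner[symmetric] power2_eq_square)
qed (use assms in simp)

text \<open>A maximizer over the compact product of unit spheres is a leading singular pair.
  Stationarity needs no derivative: \<open>u v* B\<close> has norm at most \<open>s\<close> and
  inner product \<open>s\<close> with \<open>v\<close>, so it equals \<open>s *\<^sub>R v\<close>;
  the other equation is symmetric.\<close>

lemma outer_inner_max:
  fixes B :: "real^'n^'m"
  obtains u v s where "norm u = 1" "norm v = 1" "0 \<le> s"
    "\<And>x y. B \<bullet> outer x y \<le> s * norm x * norm y"
    "\<And>y. B \<bullet> outer u y = s * (v \<bullet> y)" "\<And>x. B \<bullet> outer x v = s * (u \<bullet> x)"
proof -
  let ?K = "sphere (0::real^'m) 1 \<times> sphere (0::real^'n) 1"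
  have "compact ?K" by (intro compact_Times) auto
  moreover have "?K \<noteq> {}"
    using vector_choose_size[of 1, where 'a="real^'m"] vector_choose_size[of 1, where 'a="real^'n"]
    by fastforce
  moreover have "continuous_on ?K (\<lambda>z. B \<bullet> outer (fst z) (snd z))"
    by (intro continuous_intros outer.continuous_on)
  ultimately obtain z where z: "z \<in> ?K"
    "\<And>z'. z' \<in> ?K \<Longrightarrow> B \<bullet> outer (fst z') (snd z') \<le> B \<bullet> outer (fst z) (snd z)"
    using continuous_attains_sup[of ?K "\<lambda>z. B \<bullet> outer (fst z) (snd z)"] by blast
  define u v s where "u = fst z" and "v = snd z" and "s = B \<bullet> outer u v"
  have n: "norm u = 1" "norm v = 1"
    using z(1) by (auto simp: u_def v_def mem_Times_iff)
  have le1: "B \<bullet> outer x y \<le> s" if "norm x = 1" "norm y = 1" for x y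
    using z(2)[of "(x, y)"] that by (simp add: s_def u_def v_def)
  \<comment> \<open>Flipping the sign of \<open>u\<close> negates the value, so the maximum cannot
    be negative.\<close>
  have "B \<bullet> outer (- u) v \<le> s"
    using le1 n by simp
  then have s0: "0 \<le> s"
    by (simp add: s_def outer.minus_left)
  have le: "B \<bullet> outer x y \<le> s * norm x * norm y" for x y
  proof (cases "x = 0 \<or> y = 0")
    case False
    then have "B \<bullet> outer (x /\<^sub>R norm x) (y /\<^sub>R norm y) \<le> s"
      by (intro le1) auto
    then show ?thesis
      using False by (simp add: outer.scaleR_left outer.scaleR_right field_simps)
  qed (auto simp: outer.zero_left outer.zero_right)
  have "u v* B = s *\<^sub>R v"
  proof (rule inner_eq_if_extremal)
    show "norm (u v* B) \<le> s"
      by (rule norm_le_if_inner_le) (use s0 le[of u] n in \<open>simp_all add: inner_outer'\<close>)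
  qed (simp_all add: n s_def inner_outer')
  then have "B \<bullet> outer u y = s * (v \<bullet> y)" for y
    by (simp add: inner_outer')
  moreover have "B *v v = s *\<^sub>R u"
  proof (rule inner_eq_if_extremal)
    show "norm (B *v v) \<le> s"
      by (rule norm_le_if_inner_le)
         (use s0 le[of _ v] n in \<open>simp_all add: inner_outer inner_commute\<close>)
  qed (simp_all add: n s_def inner_outer inner_commute)
  then have "B \<bullet> outer x v = s * (u \<bullet> x)" for x
    by (simp add: inner_outer inner_commute)
  ultimately show ?thesis
    using that[OF n s0 le] by blast
qed

section \<open>Existence of the singular value decomposition\<close>

lemma orthonormal_upto_le_DIM:
  fixes U :: "nat \<Rightarrow> 'a::euclidean_space"
  assumes "orthonormal_upto k U"
  shows "k \<le> DIM('a)"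
proof -
  have "inj_on U {..<k}"
    using assms unfolding orthonormal_upto_def inj_on_def by (metis lessThan_iff zero_neq_one)
  then have "card (U ` {..<k}) = k" by (simp add: card_image)
  moreover have "pairwise orthogonal (U ` {..<k})" "0 \<notin> U ` {..<k}"
    using assms by (force simp: pairwise_def orthogonal_def orthonormal_upto_def)+
  then have "independent (U ` {..<k})"
    by (rule pairwise_orthogonal_independent)
  ultimately show ?thesis
    using independent_bound by metis
qed

text \<open>Provides padding vectors once the residual is zero: fewer vectors than the dimension
  span a proper subspace, which has a unit normal.\<close>

lemma orthonormal_upto_extend:
  fixes U :: "nat \<Rightarrow> 'a::euclidean_space"
  assumes "k < DIM('a)"
  obtains u where "norm u = 1" "\<And>i. i < k \<Longrightarrow> u \<bullet> U i = 0"
proof -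
  have "dim (U ` {..<k}) \<le> card (U ` {..<k})" by (rule dim_le_card') simp
  also have "\<dots> \<le> k" using card_image_le[of "{..<k}" U] by simp
  finally obtain x where x: "x \<noteq> 0" "\<And>y. y \<in> span (U ` {..<k}) \<Longrightarrow> orthogonal x y"
    using orthogonal_to_subspace_exists[of "U ` {..<k}"] assms by auto
  show thesis
  proof (rule that[of "x /\<^sub>R norm x"])
    show "(x /\<^sub>R norm x) \<bullet> U i = 0" if "i < k" for i
      using x(2)[of "U i"] that by (auto simp: orthogonal_def span_base)
  qed (use x in simp)
qed

text \<open>
  The SVD is built greedily: each step splits off a maximizer of \<open>x^T B y\<close> from the residual \<open>B\<close>.
  The process ends with \<open>B = 0\<close> after \<open>min m n\<close> steps, since a nonzero residual would extend both
  orthonormal systems beyond the dimension of one of the spaces.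
\<close>

definition partial_svd ::
    "nat \<Rightarrow> real^'n^'m \<Rightarrow> (nat \<Rightarrow> real^'m) \<Rightarrow> (nat \<Rightarrow> real) \<Rightarrow> (nat \<Rightarrow> real^'n) \<Rightarrow> real^'n^'m \<Rightarrow> bool"
  where "partial_svd k A U \<sigma> V B \<longleftrightarrow>
    orthonormal_upto k U \<and> orthonormal_upto k V \<and>
    (\<forall>i<k. 0 \<le> \<sigma> i) \<and> (\<forall>i j. i \<le> j \<and> j < k \<longrightarrow> \<sigma> j \<le> \<sigma> i) \<and>
    A = (\<Sum>i<k. \<sigma> i *\<^sub>R outer (U i) (V i)) + B \<and>
    (\<forall>i<k. \<forall>y. B \<bullet> outer (U i) y = 0) \<and> (\<forall>i<k. \<forall>x. B \<bullet> outer x (V i) = 0) \<and>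
    (\<forall>i<k. \<forall>x y. B \<bullet> outer x y \<le> \<sigma> i * norm x * norm y)"

lemma partial_svd_exists:
  fixes A :: "real^'n^'m"
  assumes "k \<le> svd_size TYPE(real^'n^'m)"
  shows "\<exists>U \<sigma> V B. partial_svd k A U \<sigma> V B"
  using assms
proof (induction k)
  case 0
  then show ?case by (auto simp: partial_svd_def orthonormal_upto_def)
next
  case (Suc k)
  then obtain U \<sigma> V B where IH: "partial_svd k A U \<sigma> V B"
    using Suc_leD by blast
  have o: "orthonormal_upto k U" "orthonormal_upto k V"
    and \<sigma>: "\<And>i. i < k \<Longrightarrow> 0 \<le> \<sigma> i" "\<And>i j. i \<le> j \<Longrightarrow> j < k \<Longrightarrow> \<sigma> j \<le> \<sigma> i"
    and A: "A = (\<Sum>i<k. \<sigma> i *\<^sub>R outer (U i) (V i)) + B"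
    and BU: "\<And>i y. i < k \<Longrightarrow> B \<bullet> outer (U i) y = 0"
    and BV: "\<And>i x. i < k \<Longrightarrow> B \<bullet> outer x (V i) = 0"
    and B\<sigma>: "\<And>i x y. i < k \<Longrightarrow> B \<bullet> outer x y \<le> \<sigma> i * norm x * norm y"
    using IH unfolding partial_svd_def by blast+
  have k: "k < CARD('m)" "k < CARD('n)"
    using Suc.prems by (auto simp: svd_size_def)
  obtain u v s where uv: "norm u = 1" "norm v = 1" "0 \<le> s"
    "\<And>x y. B \<bullet> outer x y \<le> s * norm x * norm y"
    "\<And>y. B \<bullet> outer u y = s * (v \<bullet> y)" "\<And>x. B \<bullet> outer x v = s * (u \<bullet> x)"
    and orth: "\<And>i. i < k \<Longrightarrow> u \<bullet> U i = 0" "\<And>i. i < k \<Longrightarrow> v \<bullet> V i = 0"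
  proof -
    obtain u v s where *: "norm u = 1" "norm v = 1" "0 \<le> s"
      "\<And>x y. B \<bullet> outer x y \<le> s * norm x * norm y"
      "\<And>y. B \<bullet> outer u y = s * (v \<bullet> y)" "\<And>x. B \<bullet> outer x v = s * (u \<bullet> x)"
      using outer_inner_max by blast
    show thesis
    \<comment> \<open>For \<open>s = 0\<close> the maximizer need not be orthogonal to the earlier
      vectors, so padding vectors with singular value 0 replace it. For \<open>s \<noteq> 0\<close>
      orthogonality is automatic, since \<open>B\<close> vanishes on the earlier \<open>U i\<close>
      and \<open>V i\<close>.\<close>
    proof (cases "s = 0")
      case True
      then have "B = 0" using *(4) by (intro eq_zero_if_inner_outer) simp
      obtain u' where "norm u' = 1" "\<And>i. i < k \<Longrightarrow> u' \<bullet> U i = 0"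
        using orthonormal_upto_extend[of k U] k by auto
      moreover obtain v' where "norm v' = 1" "\<And>i. i < k \<Longrightarrow> v' \<bullet> V i = 0"
        using orthonormal_upto_extend[of k V] k by auto
      ultimately show thesis
        using that[of u' v' 0] \<open>B = 0\<close> by simp
    next
      case False
      then have "u \<bullet> U i = 0" "v \<bullet> V i = 0" if "i < k" for i
        using *(5)[of "V i"] *(6)[of "U i"] BU BV that by auto
      then show thesis using that[OF *] by blast
    qed
  qed
  define B' where "B' = B - s *\<^sub>R outer u v"
  have B': "B' \<bullet> outer x y = B \<bullet> outer x y - s * ((u \<bullet> x) * (v \<bullet> y))" for x y
    by (simp add: B'_def inner_diff_left)
  have one: "u \<bullet> u = 1" "v \<bullet> v = 1" using uv by (simp_all add: norm_eq_1)
  \<comment> \<open>Subtracting the leading term amounts to evaluating \<open>B\<close> on the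
    components orthogonal to \<open>u\<close> and \<open>v\<close>. Projections do not increase
    norms, so the bound \<open>s\<close> carries over to \<open>B'\<close>.\<close>
  have B's: "B' \<bullet> outer x y \<le> s * norm x * norm y" for x y
  proof -
    have contr: "norm (z - (e \<bullet> z) *\<^sub>R e) \<le> norm z" if "e \<bullet> e = 1" for z e :: "'a::real_inner"
      using that by (simp add: norm_le algebra_simps inner_commute)
    have "B' \<bullet> outer x y = B \<bullet> outer (x - (u \<bullet> x) *\<^sub>R u) (y - (v \<bullet> y) *\<^sub>R v)"
      by (simp add: B' uv one inner_diff_right outer.diff_left outer.diff_right
          outer.scaleR_left outer.scaleR_right algebra_simps)
    also have "\<dots> \<le> s * norm (x - (u \<bullet> x) *\<^sub>R u) * norm (y - (v \<bullet> y) *\<^sub>R v)"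
      by (rule uv)
    also have "\<dots> \<le> s * norm x * norm y"
      using uv(3) one by (intro mult_mono contr mult_nonneg_nonneg) auto
    finally show ?thesis .
  qed
  \<comment> \<open>The invariant bounds the residual by every earlier singular value, which yields
    the descending order.\<close>
  have s\<sigma>: "s \<le> \<sigma> i" if "i < k" for i
    using B\<sigma>[OF that, of u v] uv one by simp
  let ?U = "U(k := u)" and ?V = "V(k := v)" and ?\<sigma> = "\<sigma>(k := s)"
  have "orthonormal_upto (Suc k) ?U" "orthonormal_upto (Suc k) ?V"
    using o orth uv by (auto simp: orthonormal_upto_def less_Suc_eq norm_eq_1 inner_commute)
  moreover have "0 \<le> ?\<sigma> i" if "i < Suc k" for i
    using that \<sigma> uv by (auto simp: less_Suc_eq)
  moreover have "?\<sigma> j \<le> ?\<sigma> i" if "i \<le> j" "j < Suc k" for i j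
    using that \<sigma> s\<sigma> by (auto simp: less_Suc_eq)
  moreover have "A = (\<Sum>i<Suc k. ?\<sigma> i *\<^sub>R outer (?U i) (?V i)) + B'"
    by (simp add: A B'_def)
  moreover have "B' \<bullet> outer (?U i) y = 0" "B' \<bullet> outer x (?V i) = 0" if "i < Suc k" for i x y
    using that BU BV orth uv one by (auto simp: B' less_Suc_eq)
  moreover have "B' \<bullet> outer x y \<le> ?\<sigma> i * norm x * norm y" if "i < Suc k" for i x y
  proof -
    have "s * (norm x * norm y) \<le> ?\<sigma> i * (norm x * norm y)"
      using that s\<sigma> by (intro mult_right_mono) (auto simp: less_Suc_eq)
    then show ?thesis using B's[of x y] by (simp add: mult.assoc)
  qed
  ultimately have "partial_svd (Suc k) A ?U ?\<sigma> ?V B'"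
    unfolding partial_svd_def by blast
  then show ?case by blast
qed

lemma svd_exists:
  fixes A :: "real^'n^'m"
  obtains U \<sigma> V where "is_svd A U \<sigma> V"
proof -
  let ?p = "svd_size TYPE(real^'n^'m)"
  obtain U \<sigma> V B where *: "partial_svd ?p A U \<sigma> V B"
    using partial_svd_exists by blast
  then have BU: "\<And>i y. i < ?p \<Longrightarrow> B \<bullet> outer (U i) y = 0"
    and BV: "\<And>i x. i < ?p \<Longrightarrow> B \<bullet> outer x (V i) = 0"
    by (auto simp: partial_svd_def)
  obtain u v s where uv: "norm u = 1" "norm v = 1" "0 \<le> s"
    "\<And>x y. B \<bullet> outer x y \<le> s * norm x * norm y"
    "\<And>y. B \<bullet> outer u y = s * (v \<bullet> y)" "\<And>x. B \<bullet> outer x v = s * (u \<bullet> x)"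
    using outer_inner_max by blast
  have "s = 0"
  proof (rule ccontr)
    assume "s \<noteq> 0"
    then have "u \<bullet> U i = 0" "v \<bullet> V i = 0" if "i < ?p" for i
      using uv(5)[of "V i"] uv(6)[of "U i"] BU BV that by auto
    then have "orthonormal_upto (Suc ?p) (U(?p := u))" "orthonormal_upto (Suc ?p) (V(?p := v))"
      using * uv by (auto simp: partial_svd_def orthonormal_upto_def less_Suc_eq norm_eq_1 inner_commute)
    then show False
      by (auto dest!: orthonormal_upto_le_DIM simp: svd_size_def)
  qed
  then have "B = 0" using uv(4) by (intro eq_zero_if_inner_outer) simp
  then have "is_svd A U \<sigma> V"
    using * by (auto simp: partial_svd_def is_svd_def diag_compose_def)
  then show thesis by (rule that)
qed

section \<open>Evaluating diagonal forms and their norms\<close>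

lemma svd_size_pos: "0 < svd_size TYPE(real^'n^'m)"
  by (simp add: svd_size_def)

lemma is_svdD:
  fixes A :: "real^'n^'m"
  assumes "is_svd A U \<sigma> V"
  shows "orthonormal_upto (svd_size TYPE(real^'n^'m)) U"
    and "orthonormal_upto (svd_size TYPE(real^'n^'m)) V"
    and "\<And>i. i < svd_size TYPE(real^'n^'m) \<Longrightarrow> 0 \<le> \<sigma> i"
    and "\<And>i j. i \<le> j \<Longrightarrow> j < svd_size TYPE(real^'n^'m) \<Longrightarrow> \<sigma> j \<le> \<sigma> i"
    and "A = diag_compose U \<sigma> V"
  using assms unfolding is_svd_def Let_def by blast+

lemma orthonormal_upto_norm: "orthonormal_upto k U \<Longrightarrow> i < k \<Longrightarrow> norm (U i) = 1"
  by (simp add: orthonormal_upto_def norm_eq_1)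

lemma inner_diag_compose_outer:
  fixes U :: "nat \<Rightarrow> real^'m" and V :: "nat \<Rightarrow> real^'n"
  shows "diag_compose U d V \<bullet> outer x y =
    (\<Sum>i<svd_size TYPE(real^'n^'m). d i * ((U i \<bullet> x) * (V i \<bullet> y)))"
  by (simp add: diag_compose_def inner_sum_left)

lemma inner_diag_compose_outer_orthonormal:
  fixes U :: "nat \<Rightarrow> real^'m" and V :: "nat \<Rightarrow> real^'n"
  assumes "orthonormal_upto (svd_size TYPE(real^'n^'m)) U" "i < svd_size TYPE(real^'n^'m)"
  shows "diag_compose U d V \<bullet> outer (U i) y = d i * (V i \<bullet> y)"
proof -
  have "diag_compose U d V \<bullet> outer (U i) y =
      (\<Sum>j<svd_size TYPE(real^'n^'m). if j = i then d i * (V i \<bullet> y) else 0)"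
    unfolding inner_diag_compose_outer
    using assms by (intro sum.cong) (auto simp: orthonormal_upto_def)
  then show ?thesis using assms by simp
qed

lemma inner_diag_compose_outer_orthonormal':
  fixes U :: "nat \<Rightarrow> real^'m" and V :: "nat \<Rightarrow> real^'n"
  assumes "orthonormal_upto (svd_size TYPE(real^'n^'m)) V" "i < svd_size TYPE(real^'n^'m)"
  shows "diag_compose U d V \<bullet> outer x (V i) = d i * (U i \<bullet> x)"
proof -
  have "diag_compose U d V \<bullet> outer x (V i) =
      (\<Sum>j<svd_size TYPE(real^'n^'m). if j = i then d i * (U i \<bullet> x) else 0)"
    unfolding inner_diag_compose_outer
    using assms by (intro sum.cong) (auto simp: orthonormal_upto_def)
  then show ?thesis using assms by simp
qed

lemma norm_diag_compose:
  fixes U :: "nat \<Rightarrow> real^'m" and V :: "nat \<Rightarrow> real^'n"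
  assumes "orthonormal_upto (svd_size TYPE(real^'n^'m)) U"
    and "orthonormal_upto (svd_size TYPE(real^'n^'m)) V"
  shows "(norm (diag_compose U d V))\<^sup>2 = (\<Sum>i<svd_size TYPE(real^'n^'m). (d i)\<^sup>2)"
proof -
  have "(norm (diag_compose U d V))\<^sup>2 = diag_compose U d V \<bullet> diag_compose U d V"
    by (simp add: power2_norm_eq_inner)
  also have "\<dots> = (\<Sum>i<svd_size TYPE(real^'n^'m). d i * (diag_compose U d V \<bullet> outer (U i) (V i)))"
    by (subst (2) diag_compose_def) (simp add: inner_sum_right)
  also have "\<dots> = (\<Sum>i<svd_size TYPE(real^'n^'m). (d i)\<^sup>2)"
    using assms
    by (intro sum.cong)
       (auto simp: inner_diag_compose_outer_orthonormal power2_eq_square orthonormal_upto_def)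
  finally show ?thesis .
qed

lemma diag_compose_single:
  fixes U :: "nat \<Rightarrow> real^'m" and V :: "nat \<Rightarrow> real^'n"
  assumes "\<And>i. 0 < i \<Longrightarrow> i < svd_size TYPE(real^'n^'m) \<Longrightarrow> d i = 0"
  shows "diag_compose U d V = d 0 *\<^sub>R outer (U 0) (V 0)"
proof -
  have "diag_compose U d V =
      (\<Sum>i<svd_size TYPE(real^'n^'m). if i = 0 then d 0 *\<^sub>R outer (U 0) (V 0) else 0)"
    unfolding diag_compose_def using assms by (intro sum.cong) auto
  then show ?thesis by (simp add: svd_size_pos)
qed

lemma svd_trunc_1: "svd_trunc 1 U \<sigma> V = \<sigma> 0 *\<^sub>R outer (U 0) (V 0)"
  by (simp add: svd_trunc_def diag_compose_single)

section \<open>The leading singular pair and its uniqueness\<close>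

text \<open>Bessel's inequality: \<open>z\<close> is the projection of \<open>x\<close> onto the
  span of the system, and |x - z|^2 = |x|^2 - |z|^2.\<close>

lemma bessel_upto:
  assumes "orthonormal_upto k U"
  shows "(\<Sum>i<k. (U i \<bullet> x)\<^sup>2) \<le> (norm x)\<^sup>2"
proof -
  define z where "z = (\<Sum>i<k. (U i \<bullet> x) *\<^sub>R U i)"
  have "U i \<bullet> z = (U i \<bullet> x)" if "i < k" for i
  proof -
    have "U i \<bullet> z = (\<Sum>j<k. if j = i then U i \<bullet> x else 0)"
      unfolding z_def inner_sum_right
      using assms that by (intro sum.cong) (auto simp: orthonormal_upto_def)
    then show ?thesis using that by simp
  qed
  then have zz: "z \<bullet> z = (\<Sum>i<k. (U i \<bullet> x)\<^sup>2)"
    by (subst z_def) (simp add: inner_sum_left power2_eq_square)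
  have zx: "z \<bullet> x = (\<Sum>i<k. (U i \<bullet> x)\<^sup>2)"
    by (simp add: z_def inner_sum_left power2_eq_square)
  have "0 \<le> (x - z) \<bullet> (x - z)" by simp
  also have "\<dots> = (norm x)\<^sup>2 - (\<Sum>i<k. (U i \<bullet> x)\<^sup>2)"
    using zz zx by (simp add: algebra_simps inner_commute power2_norm_eq_inner)
  finally show ?thesis by simp
qed

text \<open>The arithmetic-geometric mean inequality for each term, then Bessel for each of the two
  systems.\<close>

lemma sum_abs_inner_mult_le:
  assumes "orthonormal_upto k U" "orthonormal_upto k V" "norm x = 1" "norm y = 1"
  shows "(\<Sum>i<k. \<bar>(U i \<bullet> x) * (V i \<bullet> y)\<bar>) \<le> 1"
proof -
  have amgm: "\<bar>a * b\<bar> \<le> (a\<^sup>2 + b\<^sup>2) / 2" for a b :: real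
    using sum_squares_bound[of "\<bar>a\<bar>" "\<bar>b\<bar>"] by (simp add: abs_mult)
  have "(\<Sum>i<k. \<bar>(U i \<bullet> x) * (V i \<bullet> y)\<bar>) \<le> (\<Sum>i<k. ((U i \<bullet> x)\<^sup>2 + (V i \<bullet> y)\<^sup>2) / 2)"
    by (intro sum_mono amgm)
  also have "\<dots> = ((\<Sum>i<k. (U i \<bullet> x)\<^sup>2) + (\<Sum>i<k. (V i \<bullet> y)\<^sup>2)) / 2"
    by (simp add: sum.distrib sum_divide_distrib[symmetric])
  also have "\<dots> \<le> 1"
    using bessel_upto[OF assms(1), of x] bessel_upto[OF assms(2), of y] assms by simp
  finally show ?thesis .
qed

text \<open>The products of coordinates have absolute values of total at most 1. Index 0 takes |t|,
  so at most 1 - |t| is left for the tail, where the coefficients are at most \<open>\<tau>\<close>.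
  With \<open>\<tau> = \<sigma> 0\<close> this bounds the form by the leading singular value; with a
  smaller \<open>\<tau>\<close> it gives uniqueness.\<close>

lemma inner_diag_compose_outer_le:
  fixes U :: "nat \<Rightarrow> real^'m" and V :: "nat \<Rightarrow> real^'n"
  assumes "orthonormal_upto (svd_size TYPE(real^'n^'m)) U"
    and "orthonormal_upto (svd_size TYPE(real^'n^'m)) V"
    and "norm x = 1" "norm y = 1" "0 \<le> \<tau>"
    and "\<And>i. 0 < i \<Longrightarrow> i < svd_size TYPE(real^'n^'m) \<Longrightarrow> \<bar>\<sigma> i\<bar> \<le> \<tau>"
  defines "t \<equiv> (U 0 \<bullet> x) * (V 0 \<bullet> y)"
  shows "diag_compose U \<sigma> V \<bullet> outer x y \<le> \<sigma> 0 * t + \<tau> * (1 - \<bar>t\<bar>)"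
proof -
  let ?p = "svd_size TYPE(real^'n^'m)"
  let ?c = "\<lambda>i. (U i \<bullet> x) * (V i \<bullet> y)"
  have split: "(\<Sum>i<?p. f i) = f 0 + (\<Sum>i\<in>{..<?p} - {0}. f i)" for f :: "nat \<Rightarrow> real"
    by (rule sum.remove) (auto simp: svd_size_pos)
  have "\<sigma> i * ?c i \<le> \<tau> * \<bar>?c i\<bar>" if "i \<in> {..<?p} - {0}" for i
  proof -
    have "\<sigma> i * ?c i \<le> \<bar>\<sigma> i\<bar> * \<bar>?c i\<bar>" by (metis abs_ge_self abs_mult)
    also have "\<dots> \<le> \<tau> * \<bar>?c i\<bar>" using that assms by (intro mult_right_mono) auto
    finally show ?thesis .
  qed
  then have "(\<Sum>i\<in>{..<?p} - {0}. \<sigma> i * ?c i) \<le> \<tau> * (\<Sum>i\<in>{..<?p} - {0}. \<bar>?c i\<bar>)"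
    unfolding sum_distrib_left by (rule sum_mono)
  also have "\<dots> \<le> \<tau> * (1 - \<bar>t\<bar>)"
    using sum_abs_inner_mult_le[OF assms(1-4)] split[of "\<lambda>i. \<bar>?c i\<bar>"] assms(5)
    by (intro mult_left_mono) (auto simp: t_def)
  finally show ?thesis
    unfolding inner_diag_compose_outer split t_def by simp
qed

lemma svd_inner_outer_le:
  fixes A :: "real^'n^'m"
  assumes "is_svd A U \<sigma> V" "norm x = 1" "norm y = 1"
  shows "A \<bullet> outer x y \<le> \<sigma> 0"
proof -
  note svd = is_svdD[OF assms(1)]
  have s0: "0 \<le> \<sigma> 0" using svd svd_size_pos by blast
  define t where "t = (U 0 \<bullet> x) * (V 0 \<bullet> y)"
  have "A \<bullet> outer x y \<le> \<sigma> 0 * t + \<sigma> 0 * (1 - \<bar>t\<bar>)"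
    unfolding svd(5) t_def using svd s0 assms
    by (intro inner_diag_compose_outer_le) auto
  also have "\<dots> = \<sigma> 0 * (1 + t - \<bar>t\<bar>)" by (simp add: algebra_simps)
  also have "\<dots> \<le> \<sigma> 0 * 1" using s0 by (intro mult_left_mono) auto
  finally show ?thesis by simp
qed

lemma svd_inner_leading:
  fixes A :: "real^'n^'m"
  assumes "is_svd A U \<sigma> V"
  shows "norm (U 0) = 1" "norm (V 0) = 1" "A \<bullet> outer (U 0) y = \<sigma> 0 * (V 0 \<bullet> y)"
    "A \<bullet> outer x (V 0) = \<sigma> 0 * (U 0 \<bullet> x)"
proof -
  note svd = is_svdD[OF assms] and p = svd_size_pos[where 'm='m and 'n='n]
  show "norm (U 0) = 1" "norm (V 0) = 1"
    using svd orthonormal_upto_norm p by blast+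
  show "A \<bullet> outer (U 0) y = \<sigma> 0 * (V 0 \<bullet> y)"
    unfolding svd(5) by (rule inner_diag_compose_outer_orthonormal[OF svd(1) p])
  show "A \<bullet> outer x (V 0) = \<sigma> 0 * (U 0 \<bullet> x)"
    unfolding svd(5) by (rule inner_diag_compose_outer_orthonormal'[OF svd(2) p])
qed

text \<open>Both leading values are the maximum of the same form, hence equal. The gap then forces
  the overlap \<open>t\<close> of the two pairs to be at least 1, and unit matrices with inner
  product at least 1 coincide. The claim concerns the outer product because the vectors may change
  sign together.\<close>

lemma svd_leading_unique:
  fixes A :: "real^'n^'m"
  assumes svd: "is_svd A U \<sigma> V" and svd': "is_svd A U' \<sigma>' V'"
    and gap: "\<And>i. 0 < i \<Longrightarrow> i < svd_size TYPE(real^'n^'m) \<Longrightarrow> \<sigma> i \<le> \<tau>" "0 \<le> \<tau>" "\<tau> < \<sigma> 0"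
  shows "\<sigma>' 0 = \<sigma> 0" "outer (U' 0) (V' 0) = outer (U 0) (V 0)"
proof -
  note lead = svd_inner_leading[OF svd] and lead' = svd_inner_leading[OF svd']
  have val: "A \<bullet> outer (U 0) (V 0) = \<sigma> 0" "A \<bullet> outer (U' 0) (V' 0) = \<sigma>' 0"
    using lead lead' by (auto simp: norm_eq_1)
  show eq: "\<sigma>' 0 = \<sigma> 0"
    using val lead lead' svd_inner_outer_le[OF svd] svd_inner_outer_le[OF svd'] by (metis antisym)
  define t where "t = (U 0 \<bullet> U' 0) * (V 0 \<bullet> V' 0)"
  have "\<sigma> 0 \<le> \<sigma> 0 * t + \<tau> * (1 - \<bar>t\<bar>)"
  proof -
    have "diag_compose U \<sigma> V \<bullet> outer (U' 0) (V' 0) \<le> \<sigma> 0 * t + \<tau> * (1 - \<bar>t\<bar>)"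
      unfolding t_def using is_svdD[OF svd] gap lead'
      by (intro inner_diag_compose_outer_le) auto
    then show ?thesis using val eq is_svdD(5)[OF svd] by simp
  qed
  moreover have "\<tau> * (1 - \<bar>t\<bar>) \<le> \<tau> * (1 - t)" using gap by (intro mult_left_mono) auto
  ultimately have "0 \<le> (\<sigma> 0 - \<tau>) * (t - 1)" by (simp add: algebra_simps)
  then have "1 \<le> t" using gap(3) by (simp add: zero_le_mult_iff)
  then have "norm (outer (U' 0) (V' 0)) \<le> 1" "outer (U' 0) (V' 0) \<bullet> outer (U 0) (V 0) \<ge> 1"
    using lead' by (auto simp: t_def inner_commute)
  moreover have "norm (outer (U' 0) (V' 0) - outer (U 0) (V 0))^2 =
      2 - 2 * (outer (U' 0) (V' 0) \<bullet> outer (U 0) (V 0))"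
    using lead lead'
    by (simp add: power2_norm_eq_inner inner_diff_left inner_diff_right inner_commute norm_eq_1)
  ultimately have "norm (outer (U' 0) (V' 0) - outer (U 0) (V 0))^2 \<le> 0" by linarith
  then show "outer (U' 0) (V' 0) = outer (U 0) (V 0)" by simp
qed

text \<open>The squares of the singular values sum to 1, and (1 - e^2/2)^2 >= 1 - e^2 leaves at most
  e^2 for the tail. Here \<open>e\<close> is a free parameter, so that the bound serves the
  normalized truncation of Phase I as well as \<open>X\<close>.\<close>

lemma svd_unit_tail:
  fixes A :: "real^'n^'m"
  assumes svd: "is_svd A U \<sigma> V" and A: "norm A = 1"
    and e: "0 \<le> e" "e \<le> 1" "1 - e\<^sup>2 / 2 \<le> \<sigma> 0"
  shows "\<sigma> 0 \<le> 1" and "norm (A - \<sigma> 0 *\<^sub>R outer (U 0) (V 0)) \<le> e"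
    and "\<And>i. 0 < i \<Longrightarrow> i < svd_size TYPE(real^'n^'m) \<Longrightarrow> \<sigma> i \<le> e"
proof -
  let ?p = "svd_size TYPE(real^'n^'m)"
  note o = is_svdD[OF svd] and lead = svd_inner_leading[OF svd]
  have total: "(\<sigma> 0)\<^sup>2 + (\<Sum>i\<in>{..<?p} - {0}. (\<sigma> i)\<^sup>2) = 1"
    using norm_diag_compose[OF o(1,2), of \<sigma>] A
      sum.remove[of "{..<?p}" 0 "\<lambda>i. (\<sigma> i)\<^sup>2"] svd_size_pos[where 'm='m and 'n='n]
    by (simp flip: o(5))
  have "(\<sigma> 0)\<^sup>2 \<le> 1\<^sup>2" using total sum_nonneg[of "{..<?p} - {0}" "\<lambda>i. (\<sigma> i)\<^sup>2"] by simp
  then show "\<sigma> 0 \<le> 1" by (rule power2_le_imp_le) simp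
  have "e\<^sup>2 \<le> 1" using e by (simp add: abs_square_le_1)
  then have "(1 - e\<^sup>2 / 2)\<^sup>2 \<le> (\<sigma> 0)\<^sup>2" using e by (intro power_mono) auto
  moreover have "(1 - e\<^sup>2 / 2)\<^sup>2 = 1 - e\<^sup>2 + (e\<^sup>2)\<^sup>2 / 4" by (simp add: power2_eq_square algebra_simps)
  ultimately have s2: "1 - (\<sigma> 0)\<^sup>2 \<le> e\<^sup>2" using zero_le_power2[of "e\<^sup>2"] by linarith
  have "(norm (A - \<sigma> 0 *\<^sub>R outer (U 0) (V 0)))\<^sup>2 = 1 - (\<sigma> 0)\<^sup>2"
  proof -
    have "A \<bullet> outer (U 0) (V 0) = \<sigma> 0" using lead by (simp add: norm_eq_1)
    moreover have "A \<bullet> A = 1" using A by (simp add: norm_eq_1)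
    ultimately show ?thesis using lead unfolding power2_norm_eq_inner
      by (simp add: inner_diff_left inner_diff_right inner_commute norm_eq_1 power2_eq_square)
  qed
  then show "norm (A - \<sigma> 0 *\<^sub>R outer (U 0) (V 0)) \<le> e"
    using s2 e(1) power2_le_imp_le by metis
  show "\<sigma> i \<le> e" if "0 < i" "i < ?p" for i
  proof -
    have "(\<sigma> i)\<^sup>2 \<le> (\<Sum>i\<in>{..<?p} - {0}. (\<sigma> i)\<^sup>2)"
      using that by (intro member_le_sum) auto
    then show ?thesis using total s2 e(1) by (intro power2_le_imp_le[of "\<sigma> i" e]) auto
  qed
qed

text \<open>For unit matrices |A - u v^T|^2 = 2 - 2 <A, u v^T>, and this inner product is at most
  \<open>\<sigma> 0\<close>.\<close>

lemma svd_near_rank_one: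
  fixes A :: "real^'n^'m"
  assumes svd: "is_svd A U \<sigma> V" and n: "norm A = 1" "norm u = 1" "norm v = 1"
  shows "1 - (norm (A - outer u v))\<^sup>2 / 2 \<le> \<sigma> 0"
proof -
  have "A \<bullet> A = 1" "u \<bullet> u = 1" "v \<bullet> v = 1" using n by (simp_all add: norm_eq_1)
  then have "(norm (A - outer u v))\<^sup>2 = 2 - 2 * (A \<bullet> outer u v)"
    by (simp add: power2_norm_eq_inner inner_diff_left inner_diff_right inner_commute)
  then show ?thesis using svd_inner_outer_le[OF svd n(2,3)] by (simp add: field_simps)
qed

section \<open>Orthogonal projection and the subspace angle\<close>

lemma orth_proj_in:
  assumes "subspace M"
  shows "orth_proj M X \<in> M"
  using theI'[OF orth_proj_unique_exists[OF assms, of X]] unfolding orth_proj_def by blast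

lemma inner_orth_proj:
  assumes "subspace M" "Z \<in> M"
  shows "orth_proj M X \<bullet> Z = X \<bullet> Z"
  using theI'[OF orth_proj_unique_exists[OF assms(1), of X]] assms(2)
  unfolding orth_proj_def orthogonal_def by (auto simp: inner_diff_left)

lemma orth_proj_scaleR:
  assumes "subspace M"
  shows "orth_proj M (c *\<^sub>R X) = c *\<^sub>R orth_proj M X"
proof -
  have "c *\<^sub>R orth_proj M X \<in> M"
    using assms by (simp add: orth_proj_in subspace_scale)
  moreover have "orthogonal (c *\<^sub>R X - c *\<^sub>R orth_proj M X) Z" if "Z \<in> M" for Z
    using inner_orth_proj[OF assms that] by (simp add: orthogonal_def inner_diff_left)
  ultimately show ?thesis
    unfolding orth_proj_def[of M "c *\<^sub>R X"]
    using orth_proj_unique_exists[OF assms, of "c *\<^sub>R X"] by (intro the1_equality) auto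
qed

text \<open>Compactness of the unit spheres makes the maximum attained. The value 1 would be
  equality in Cauchy-Schwarz and put a unit vector into both subspaces, so the maximum is below 1
  and the angle positive. If \<open>C\<close> is empty, the value 0 gives the angle pi/2. The last
  conclusion is the homogeneous form used later.\<close>

lemma subspace_angle_exists:
  fixes S T :: "'a::euclidean_space set"
  assumes S: "subspace S" and T: "subspace T" and triv: "S \<inter> T = {0}"
  obtains \<theta> where "0 < \<theta>" "\<theta> \<le> pi / 2" "is_subspace_angle \<theta> S T"
    "\<And>X Y. X \<in> S \<Longrightarrow> Y \<in> T \<Longrightarrow> \<bar>X \<bullet> Y\<bar> \<le> cos \<theta> * norm X * norm Y"
proof -
  define C where "C = {\<bar>X \<bullet> Y\<bar> / (norm X * norm Y) | X Y. X \<in> S \<and> X \<noteq> 0 \<and> Y \<in> T \<and> Y \<noteq> 0}"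
  have "\<exists>c. 0 \<le> c \<and> c < 1 \<and> (if C = {} then c = 0 else c \<in> C \<and> (\<forall>x\<in>C. x \<le> c))"
  proof (cases "C = {}")
    case False
    define K where "K = (S \<inter> sphere 0 1) \<times> (T \<inter> sphere 0 1)"
    have norm_K: "(X /\<^sub>R norm X, Y /\<^sub>R norm Y) \<in> K"
      if "X \<in> S" "X \<noteq> 0" "Y \<in> T" "Y \<noteq> 0" for X Y
      using that S T by (auto simp: K_def subspace_scale)
    have "compact K"
      unfolding K_def using S T by (intro compact_Times closed_Int_compact closed_subspace) auto
    moreover have "K \<noteq> {}"
      using False norm_K unfolding C_def by blast
    moreover have "continuous_on K (\<lambda>z. \<bar>fst z \<bullet> snd z\<bar>)"
      by (intro continuous_intros)
    ultimately obtain z where z: "z \<in> K" "\<And>z'. z' \<in> K \<Longrightarrow> \<bar>fst z' \<bullet> snd z'\<bar> \<le> \<bar>fst z \<bullet> snd z\<bar>"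
      using continuous_attains_sup[of K "\<lambda>z. \<bar>fst z \<bullet> snd z\<bar>"] by blast
    obtain X Y where zXY: "z = (X, Y)" by (cases z)
    then have XY: "X \<in> S" "Y \<in> T" "norm X = 1" "norm Y = 1"
      using z(1) by (auto simp: K_def)
    let ?c = "\<bar>X \<bullet> Y\<bar>"
    have "?c \<noteq> 1"
    proof
      assume "?c = 1"
      then have "X = Y \<or> X = - Y"
        using XY norm_cauchy_schwarz_abs_eq[of X Y] by auto
      then have "X \<in> S \<inter> T"
        using XY T by (auto simp: subspace_neg)
      then show False using triv XY by auto
    qed
    moreover have "?c \<le> 1" using Cauchy_Schwarz_ineq2[of X Y] XY by simp
    moreover have "?c \<in> C"
      unfolding C_def using XY by force
    moreover have "x \<le> ?c" if x: "x \<in> C" for x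
    proof -
      obtain X' Y' where *: "x = \<bar>X' \<bullet> Y'\<bar> / (norm X' * norm Y')" "X' \<in> S" "X' \<noteq> 0" "Y' \<in> T" "Y' \<noteq> 0"
        using x unfolding C_def by blast
      have "\<bar>(X' /\<^sub>R norm X') \<bullet> (Y' /\<^sub>R norm Y')\<bar> = x"
        using * by (simp add: abs_mult divide_inverse mult_ac)
      then show ?thesis
        using z(2)[OF norm_K[OF *(2-5)]] zXY by simp
    qed
    ultimately show ?thesis using False by (intro exI[of _ ?c]) auto
  qed (auto intro: exI[of _ 0])
  then obtain c where c: "0 \<le> c" "c < 1" "if C = {} then c = 0 else c \<in> C \<and> (\<forall>x\<in>C. x \<le> c)"
    by blast
  have cos: "cos (arccos c) = c" using c by simp
  show thesis
  proof
    show "0 < arccos c" using c arccos_less_arccos[of c 1] by simp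
    show "arccos c \<le> pi / 2" using c by (intro arccos_le_pi2) auto
    show "is_subspace_angle (arccos c) S T"
      unfolding is_subspace_angle_def Let_def C_def[symmetric] cos
      using c \<open>0 < arccos c\<close> \<open>arccos c \<le> pi / 2\<close> by auto
    fix X Y assume XY: "X \<in> S" "Y \<in> T"
    show "\<bar>X \<bullet> Y\<bar> \<le> cos (arccos c) * norm X * norm Y"
    proof (cases "X = 0 \<or> Y = 0")
      case False
      then have "\<bar>X \<bullet> Y\<bar> / (norm X * norm Y) \<in> C"
        using XY unfolding C_def by blast
      then have "\<bar>X \<bullet> Y\<bar> / (norm X * norm Y) \<le> c"
        using c(3) by (auto split: if_splits)
      then show ?thesis using False cos by (simp add: field_simps)
    qed auto
  qed
qed

section \<open>The contraction estimate\<close>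

text \<open>The chord between two unit vectors is at most the tangent of their angle, here |w| /
  r.\<close>

lemma norm_normalized_diff_le:
  fixes w x :: "'a::real_inner"
  assumes "norm x = 1" "w \<bullet> x = 0" "0 < r" and Z: "Z = w + r *\<^sub>R x"
  shows "norm (Z /\<^sub>R norm Z - x) \<le> norm w / r"
proof -
  have x: "x \<bullet> x = 1" using assms by (simp add: norm_eq_1)
  have Zx: "Z \<bullet> x = r" using assms x by (simp add: inner_add_left)
  define N where "N = norm Z"
  have N2: "N\<^sup>2 = (norm w)\<^sup>2 + r\<^sup>2"
    unfolding N_def power2_norm_eq_inner using assms x
    by (simp add: inner_add_left inner_add_right inner_commute power2_eq_square)
  then have "r\<^sup>2 \<le> N\<^sup>2" by simp
  then have rN: "r \<le> N" by (rule power2_le_imp_le) (simp add: N_def)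
  have "(norm (Z /\<^sub>R N - x))\<^sup>2 = 2 - 2 * r / N"
  proof -
    have "norm Z \<noteq> 0" using rN \<open>0 < r\<close> N_def by auto
    then have "(Z /\<^sub>R N) \<bullet> (Z /\<^sub>R N) = 1"
      unfolding dot_square_norm by (simp add: N_def)
    moreover have "(Z /\<^sub>R N) \<bullet> x = r / N" "x \<bullet> (Z /\<^sub>R N) = r / N"
      using Zx by (simp_all add: inner_commute[of x Z] divide_inverse)
    ultimately show ?thesis
      unfolding power2_norm_eq_inner inner_diff_left inner_diff_right using x by simp
  qed
  also have "\<dots> = 2 * (N - r) / N" using rN \<open>0 < r\<close> by (simp add: field_simps)
  \<comment> \<open>From here r <= N is used twice, aiming at (N - r)(N + r) = |w|^2.\<close>
  also have "\<dots> \<le> 2 * (N - r) / r" using rN \<open>0 < r\<close> by (intro divide_left_mono) auto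
  also have "\<dots> = (N - r) * (2 * r) / r\<^sup>2" using \<open>0 < r\<close> by (simp add: power2_eq_square)
  also have "\<dots> \<le> (N - r) * (N + r) / r\<^sup>2"
    using rN by (intro divide_right_mono mult_left_mono) auto
  also have "\<dots> = (norm w / r)\<^sup>2"
    using N2 by (simp add: power_divide algebra_simps power2_eq_square)
  finally show ?thesis
    unfolding N_def by (rule power2_le_imp_le) (use \<open>0 < r\<close> in simp)
qed

text \<open>The angle bound enters twice, for the pairs \<open>h\<close>, \<open>k\<close> and
  \<open>w\<close>, \<open>k\<close>, so the error c e comes with a second factor c + |k|. That
  spare factor pays for all second-order losses, which leaves c e without an error term.\<close>

lemma leading_projection_contracts:
  fixes M :: "(real^'n^'m) set" and u :: "real^'m" and v :: "real^'n"
  assumes M: "subspace M" and uv: "norm u = 1" "norm v = 1" and XsM: "outer u v \<in> M"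
    and c: "0 \<le> c" "c < 1"
    and angle: "\<And>A x y. A \<in> tangent_sphere M (outer u v) \<Longrightarrow>
        \<bar>A \<bullet> (outer u y + outer x v)\<bar> \<le> c * norm A * norm (outer u y + outer x v)"
    and X: "X \<in> M" "norm X = 1" and e_def: "e = norm (X - outer u v)"
    and e: "e \<le> 1 / 10" "e \<le> (1 - c) / 6"
    and svd: "is_svd X U \<sigma> V"
  defines "Z \<equiv> orth_proj M (\<sigma> 0 *\<^sub>R outer (U 0) (V 0))"
  shows "Z \<noteq> 0" "norm (Z /\<^sub>R norm Z - outer u v) \<le> c * e"
proof -
  define s where "s = \<sigma> 0"
  let ?T = "s *\<^sub>R outer (U 0) (V 0)"
  let ?Xs = "outer u v"
  define R where "R = X - ?T"
  have one: "u \<bullet> u = 1" "v \<bullet> v = 1" using uv by (simp_all add: norm_eq_1)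
  have e0: "0 \<le> e" by (simp add: e_def)
  have ee: "e * e \<le> 1 / 100" using mult_mono[OF e(1) e(1)] e0 by simp
  have s_ge: "1 - e\<^sup>2 / 2 \<le> s"
    using svd_near_rank_one[OF svd X(2) uv] by (simp add: s_def e_def)
  have s9: "9 / 10 \<le> s" using s_ge ee by (simp add: power2_eq_square)
  have s1: "s \<le> 1" and Re: "norm R \<le> e"
    using svd_unit_tail[OF svd X(2) e0] s_ge e by (simp_all add: s_def R_def)
  note lead = svd_inner_leading[OF svd, folded s_def]
  have one': "U 0 \<bullet> U 0 = 1" "V 0 \<bullet> V 0 = 1" using lead(1,2) by (simp_all add: norm_eq_1)
  have RU: "R \<bullet> outer (U 0) y = 0" for y
    by (simp add: R_def inner_diff_left lead one')
  have RV: "R \<bullet> outer x (V 0) = 0" for x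
    by (simp add: R_def inner_diff_left lead one')
  have TXs: "norm (?T - ?Xs) \<le> 2 * e"
  proof -
    have *: "?T - ?Xs = (X - ?Xs) - R" by (simp add: R_def)
    show ?thesis using norm_triangle_ineq4[of "X - ?Xs" R] Re unfolding e_def * by linarith
  qed
  \<comment> \<open>The singular vectors are split along and across \<open>u\<close> and
    \<open>v\<close>. Their common sign is free, so lower bounds are available only for the squares
    of \<open>\<alpha>\<close> and \<open>\<beta>\<close>.\<close>
  define \<alpha> \<beta> where "\<alpha> = u \<bullet> U 0" and "\<beta> = v \<bullet> V 0"
  define a b where "a = U 0 - \<alpha> *\<^sub>R u" and "b = V 0 - \<beta> *\<^sub>R v"
  have ua: "u \<bullet> a = 0" and vb: "v \<bullet> b = 0"
    by (simp_all add: a_def b_def \<alpha>_def \<beta>_def inner_diff_right one)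
  have U0: "U 0 = \<alpha> *\<^sub>R u + a" and V0: "V 0 = \<beta> *\<^sub>R v + b"
    by (simp_all add: a_def b_def)
  have aa: "a \<bullet> a = 1 - \<alpha>\<^sup>2" and bb: "b \<bullet> b = 1 - \<beta>\<^sup>2"
    unfolding a_def b_def
    by (simp_all add: inner_diff_left inner_diff_right one one' inner_commute power2_eq_square
        flip: \<alpha>_def \<beta>_def)
  \<comment> \<open>Cancelling z leaves s z <= 2 e, and e <= 1/10 with s >= 9/10 gives z <=
    2/9.\<close>
  have small: "z \<le> 1 / 3" if "s * (z * z) \<le> 2 * e * z" "0 \<le> z" for z :: real
  proof (rule ccontr)
    assume "\<not> z \<le> 1 / 3"
    then have "0 < z" "s * z \<le> 2 * e" using that by (auto simp: algebra_simps mult_le_cancel_left)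
    moreover have "9 / 10 * z \<le> s * z" using s9 \<open>0 < z\<close> by (intro mult_right_mono) auto
    ultimately show False using \<open>\<not> z \<le> 1 / 3\<close> e by linarith
  qed
  have "s * (norm a * norm a) \<le> 2 * e * norm a"
  proof -
    \<comment> \<open>\<open>?Xs\<close> vanishes on \<open>outer a (V 0)\<close> because
      \<open>a\<close> is orthogonal to \<open>u\<close>.\<close>
    have "s * (norm a * norm a) = (?T - ?Xs) \<bullet> outer a (V 0)"
      using ua by (simp add: inner_diff_left lead(2) U0 inner_add_left dot_square_norm power2_eq_square
          flip: V0)
    also have "\<dots> \<le> norm (?T - ?Xs) * norm a"
      using inner_outer_le[of "?T - ?Xs" a "V 0"] lead by simp
    also have "\<dots> \<le> 2 * e * norm a" using TXs by (intro mult_right_mono) auto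
    finally show ?thesis .
  qed
  then have a3: "norm a \<le> 1 / 3" by (rule small) simp
  have "s * (norm b * norm b) \<le> 2 * e * norm b"
  proof -
    have "s * (norm b * norm b) = (?T - ?Xs) \<bullet> outer (U 0) b"
      using vb by (simp add: inner_diff_left lead(1) V0 inner_add_left dot_square_norm power2_eq_square
          flip: U0)
    also have "\<dots> \<le> norm (?T - ?Xs) * norm b"
      using inner_outer_le[of "?T - ?Xs" "U 0" b] lead by simp
    also have "\<dots> \<le> 2 * e * norm b" using TXs by (intro mult_right_mono) auto
    finally show ?thesis .
  qed
  then have b3: "norm b \<le> 1 / 3" by (rule small) simp
  have "(norm a)\<^sup>2 \<le> (1 / 3)\<^sup>2" "(norm b)\<^sup>2 \<le> (1 / 3)\<^sup>2"
    using a3 b3 by (intro power_mono; simp)+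
  then have \<alpha>2: "8 / 9 \<le> \<alpha>\<^sup>2" "8 / 9 \<le> \<beta>\<^sup>2"
    using aa bb unfolding dot_square_norm by (simp_all add: power_divide)
  have "\<alpha>\<^sup>2 \<le> 1" "\<beta>\<^sup>2 \<le> 1" using aa bb inner_ge_zero[of a] inner_ge_zero[of b] by linarith+
  then have \<alpha>1: "\<bar>\<alpha>\<bar> \<le> 1" "\<bar>\<beta>\<bar> \<le> 1" by (simp_all add: abs_square_le_1)
  \<comment> \<open>\<open>k\<close> is the component of \<open>?T\<close> in the tangent space at
    \<open>?Xs\<close> orthogonal to \<open>?Xs\<close>; the remaining \<open>outer a b\<close> is
    normal to that space.\<close>
  define k where "k = outer u ((s * \<alpha>) *\<^sub>R b) + outer ((s * \<beta>) *\<^sub>R a) v"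
  have kk: "k \<bullet> k = s\<^sup>2 * (\<alpha>\<^sup>2 * (norm b)\<^sup>2 + \<beta>\<^sup>2 * (norm a)\<^sup>2)"
    using ua vb one unfolding k_def power2_norm_eq_inner
    by (simp add: inner_add_left inner_add_right inner_commute power2_eq_square algebra_simps)
  \<comment> \<open>The lower bounds give the factor (9/10)^2 * 8/9 = 18/25, hence the constant
    25/18 <= 2. This makes the normal part, of size |a| |b|, quadratic in |k|.\<close>
  have ab2: "(norm a)\<^sup>2 + (norm b)\<^sup>2 \<le> 2 * (norm k)\<^sup>2"
  proof -
    have "(9 / 10)\<^sup>2 \<le> s\<^sup>2" using s9 by (intro power_mono) auto
    then have "(9 / 10)\<^sup>2 * (8 / 9 * (norm b)\<^sup>2 + 8 / 9 * (norm a)\<^sup>2) \<le> k \<bullet> k"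
      unfolding kk using \<alpha>2 by (intro mult_mono add_mono mult_right_mono) auto
    then have "18 * (norm a)\<^sup>2 + 18 * (norm b)\<^sup>2 \<le> 25 * (norm k)\<^sup>2"
      unfolding dot_square_norm by (simp add: power2_eq_square algebra_simps)
    then show ?thesis using zero_le_power2[of "norm a"] zero_le_power2[of "norm b"] by linarith
  qed
  then have ab: "norm a * norm b \<le> (norm k)\<^sup>2"
    using sum_squares_bound[of "norm a" "norm b"] by simp
  have T: "?T = (s * \<alpha> * \<beta>) *\<^sub>R ?Xs + k + s *\<^sub>R outer a b"
    by (subst U0, subst V0) (simp add: k_def outer.add_left outer.add_right outer.scaleR_left
        outer.scaleR_right algebra_simps)
  have kXs: "k \<bullet> ?Xs = 0" and kab: "k \<bullet> outer a b = 0"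
    using ua vb by (simp_all add: k_def inner_add_left inner_commute[of a u] inner_commute[of b v])
  have kT: "k \<bullet> ?T = (norm k)\<^sup>2"
    unfolding T by (simp add: inner_add_right kXs kab power2_norm_eq_inner)
  \<comment> \<open>\<open>R\<close> vanishes on the tangent space at \<open>T\<close>, so only the tilt between the two tangent spaces counts.\<close>
  have kR: "\<bar>R \<bullet> k\<bar> \<le> 2 * e * (norm k)\<^sup>2"
  proof -
    have "R \<bullet> outer u b = R \<bullet> outer (u - \<alpha> *\<^sub>R U 0) b" "R \<bullet> outer a v = R \<bullet> outer a (v - \<beta> *\<^sub>R V 0)"
      by (simp_all add: outer.diff_left outer.diff_right outer.scaleR_left outer.scaleR_right
          inner_diff_right RU RV)
    moreover have "norm (u - \<alpha> *\<^sub>R U 0) = norm a" "norm (v - \<beta> *\<^sub>R V 0) = norm b"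
      unfolding norm_eq a_def b_def
      by (simp_all add: inner_diff_left inner_diff_right one one' inner_commute
          flip: \<alpha>_def \<beta>_def)
    moreover have "\<bar>R \<bullet> outer x y\<bar> \<le> e * (norm x * norm y)" for x y
      using Cauchy_Schwarz_ineq2[of R "outer x y"] mult_right_mono[OF Re, of "norm x * norm y"]
      by simp
    note this[of "u - \<alpha> *\<^sub>R U 0" b] this[of a "v - \<beta> *\<^sub>R V 0"]
    ultimately have *: "\<bar>R \<bullet> outer u b\<bar> \<le> e * (norm k)\<^sup>2" "\<bar>R \<bullet> outer a v\<bar> \<le> e * (norm k)\<^sup>2"
      using mult_left_mono[OF ab e0] by simp_all
    have "\<bar>s * \<alpha>\<bar> \<le> 1" "\<bar>s * \<beta>\<bar> \<le> 1"
      using \<alpha>1 s1 s9 by (simp_all add: abs_mult mult_le_one)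
    then have "\<bar>(s * \<alpha>) * (R \<bullet> outer u b)\<bar> \<le> 1 * (e * (norm k)\<^sup>2)"
      "\<bar>(s * \<beta>) * (R \<bullet> outer a v)\<bar> \<le> 1 * (e * (norm k)\<^sup>2)"
      unfolding abs_mult[of "_ * _" "R \<bullet> _"] using * by (intro mult_mono; simp)+
    moreover have "R \<bullet> k = (s * \<alpha>) * (R \<bullet> outer u b) + (s * \<beta>) * (R \<bullet> outer a v)"
      by (simp add: k_def inner_add_right outer.scaleR_left outer.scaleR_right)
    ultimately show ?thesis by linarith
  qed
  have XsXs: "?Xs \<bullet> ?Xs = 1" by (simp add: one)
  have TS: "A \<in> tangent_sphere M ?Xs \<longleftrightarrow> A \<in> M \<and> A \<bullet> ?Xs = 0" for A
    by (auto simp: tangent_sphere_def orthogonal_comp_def orthogonal_def inner_commute)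
  \<comment> \<open>\<open>h\<close> is the part of \<open>X\<close> tangent to the sphere. Removing
    the \<open>?Xs\<close>-component from \<open>X\<close> or from \<open>X - ?Xs\<close> gives the
    same matrix, hence |h| <= e.\<close>
  define h where "h = X - (X \<bullet> ?Xs) *\<^sub>R ?Xs"
  have hTS: "h \<in> tangent_sphere M ?Xs"
    unfolding TS h_def using M X(1) XsM XsXs by (auto simp: subspace_diff subspace_scale inner_diff_left)
  have "norm h \<le> e"
  proof -
    have "h = (X - ?Xs) - ((X - ?Xs) \<bullet> ?Xs) *\<^sub>R ?Xs"
      by (simp add: h_def inner_diff_left one algebra_simps)
    then show ?thesis
      unfolding e_def norm_le using XsXs
      by (simp add: inner_diff_left[of "X - ?Xs"] inner_diff_right[of _ "X - ?Xs"]
          inner_commute[of ?Xs "X - ?Xs"] del: inner_outer_outer)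
  qed
  \<comment> \<open>Pairing \<open>k\<close> with \<open>?T = X - R\<close> isolates |k|^2. Under
    this pairing \<open>X\<close> can be replaced by \<open>h\<close>, to which the angle bound
    applies.\<close>
  have "(norm k)\<^sup>2 \<le> c * e * norm k + 2 * e * (norm k)\<^sup>2"
  proof -
    have "(norm k)\<^sup>2 = k \<bullet> X - R \<bullet> k"
      unfolding kT[symmetric] by (simp add: R_def inner_diff_left inner_diff_right inner_commute[of _ k])
    also have "k \<bullet> X = h \<bullet> k"
      using kXs by (simp add: h_def inner_diff_right inner_commute[of _ k])
    also have "h \<bullet> k - R \<bullet> k \<le> c * norm h * norm k + 2 * e * (norm k)\<^sup>2"
      using angle[OF hTS, of "(s * \<alpha>) *\<^sub>R b" "(s * \<beta>) *\<^sub>R a"] kR unfolding k_def[symmetric]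
      by linarith
    also have "c * norm h * norm k \<le> c * e * norm k"
      using \<open>norm h \<le> e\<close> c by (intro mult_right_mono mult_left_mono) auto
    finally show ?thesis by simp
  qed
  then have "norm k * (norm k * (1 - 2 * e)) \<le> norm k * (c * e)"
    by (simp add: power2_eq_square algebra_simps)
  then have K: "norm k * (1 - 2 * e) \<le> c * e"
    using c e0 by (cases "k = 0") (auto simp: mult_le_cancel_left)
  have K2: "norm k \<le> 2 * e"
  proof -
    have "norm k * (1 / 2) \<le> norm k * (1 - 2 * e)" using e by (intro mult_left_mono) auto
    moreover have "c * e \<le> 1 * e" using c e0 by (intro mult_right_mono) auto
    ultimately show ?thesis using K by linarith
  qed
  define r where "r = ?T \<bullet> ?Xs"
  have Z_eq: "Z = orth_proj M ?T" by (simp add: Z_def s_def)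
  have ZXs: "Z \<bullet> ?Xs = r" unfolding Z_eq r_def by (rule inner_orth_proj[OF M XsM])
  have r: "1 - 2 * e \<le> r"
  proof -
    have "- (2 * e) \<le> (?T - ?Xs) \<bullet> ?Xs"
      using Cauchy_Schwarz_ineq2[of "?T - ?Xs" ?Xs] TXs uv by simp
    then show ?thesis unfolding r_def inner_diff_left XsXs by linarith
  qed
  then have r0: "0 < r" using e by linarith
  then show "Z \<noteq> 0" using ZXs by auto
  \<comment> \<open>\<open>w\<close> is the tangential error of \<open>Z\<close>; after
    normalization the distance to \<open>?Xs\<close> is at most |w| / r.\<close>
  define w where "w = Z - r *\<^sub>R ?Xs"
  have wXs: "w \<bullet> ?Xs = 0" unfolding w_def inner_diff_left inner_scaleR_left XsXs ZXs by simp
  have wM: "w \<in> M"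
    unfolding w_def Z_eq using M XsM by (simp add: orth_proj_in subspace_diff subspace_scale)
  have wTS: "w \<in> tangent_sphere M ?Xs" using wM wXs TS by blast
  have "Z = w + r *\<^sub>R ?Xs" by (simp add: w_def)
  then have "w \<bullet> Z = w \<bullet> w" using wXs by (simp only: inner_add_right inner_scaleR_right)
  then have "norm w * norm w = w \<bullet> Z" by (simp add: dot_square_norm power2_eq_square)
  \<comment> \<open>As \<open>w\<close> lies in \<open>M\<close>, the projection drops out of the
    pairing; orthogonality to \<open>?Xs\<close> then removes the leading term of
    \<open>?T\<close>.\<close>
  also have "w \<bullet> Z = w \<bullet> ?T"
    using inner_orth_proj[OF M wM, of ?T] Z_eq by (simp add: inner_commute)
  also have "\<dots> = w \<bullet> k + s * (w \<bullet> outer a b)"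
    unfolding T inner_add_right inner_scaleR_right wXs by simp
  also have "\<dots> \<le> c * norm w * norm k + norm w * (norm k)\<^sup>2"
  proof (rule add_mono)
    show "w \<bullet> k \<le> c * norm w * norm k"
      using angle[OF wTS, of "(s * \<alpha>) *\<^sub>R b" "(s * \<beta>) *\<^sub>R a"] unfolding k_def[symmetric] by linarith
    have "s * (w \<bullet> outer a b) \<le> 1 * (norm w * (norm a * norm b))"
    proof -
      have "s * (w \<bullet> outer a b) \<le> s * (norm w * (norm a * norm b))"
        using inner_outer_le[of w a b] s9 by (intro mult_left_mono) (auto simp: mult.assoc)
      also have "\<dots> \<le> 1 * (norm w * (norm a * norm b))" using s1 by (intro mult_right_mono) auto
      finally show ?thesis .
    qed
    also have "\<dots> \<le> norm w * (norm k)\<^sup>2" using ab by (simp add: mult_left_mono)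
    finally show "s * (w \<bullet> outer a b) \<le> norm w * (norm k)\<^sup>2" .
  qed
  finally have "norm w * norm w \<le> norm w * ((c + norm k) * norm k)"
    by (simp add: power2_eq_square algebra_simps)
  then have "norm w \<le> (c + norm k) * norm k"
    using c by (cases "w = 0") (auto simp: mult_le_cancel_left)
  \<comment> \<open>c + |k| <= c + 2 e <= 1 - 4 e, where the last inequality is
    \<open>e \<le> (1 - c) / 6\<close>. Since 1 - 4 e <= (1 - 2 e)^2, one factor 1 - 2 e pays for
    the bound on |k| and the other for \<open>r\<close>.\<close>
  also have "\<dots> \<le> (1 - 4 * e) * norm k"
    using K2 e by (intro mult_right_mono) auto
  finally have "norm w * (1 - 2 * e) \<le> (1 - 4 * e) * (norm k * (1 - 2 * e))"
    using mult_right_mono[of "norm w" "(1 - 4 * e) * norm k" "1 - 2 * e"] e by (simp add: mult.assoc)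
  also have "\<dots> \<le> (1 - 4 * e) * (c * e)" using K e by (intro mult_left_mono) auto
  also have "\<dots> \<le> ((1 - 2 * e) * r) * (c * e)"
  proof (rule mult_right_mono)
    have "(1 - 2 * e) * (1 - 2 * e) \<le> (1 - 2 * e) * r" using r e by (intro mult_left_mono) auto
    moreover have "1 - 4 * e \<le> (1 - 2 * e) * (1 - 2 * e)" by (simp add: algebra_simps)
    ultimately show "1 - 4 * e \<le> (1 - 2 * e) * r" by linarith
  qed (use c e0 in simp)
  finally have "(1 - 2 * e) * norm w \<le> (1 - 2 * e) * (r * (c * e))" by (simp add: algebra_simps)
  then have "norm w \<le> r * (c * e)" using e by (simp add: mult_le_cancel_left)
  moreover have "norm (Z /\<^sub>R norm Z - ?Xs) \<le> norm w / r"
    using uv wXs r0 by (intro norm_normalized_diff_le) (auto simp: w_def)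
  moreover have "norm w / r \<le> c * e"
    using \<open>norm w \<le> r * (c * e)\<close> r0 by (simp add: field_simps)
  ultimately show "norm (Z /\<^sub>R norm Z - ?Xs) \<le> c * e" by linarith
qed

section \<open>Phase I and Phase II near a rank-one matrix\<close>

lemma diag_compose_scaleR: "diag_compose U (\<lambda>i. c * d i) V = c *\<^sub>R diag_compose U d V"
  by (simp add: diag_compose_def scaleR_sum_right)

text \<open>\<open>s\<close> may exceed 1, since small singular values can lie above
  \<open>tol\<close>. The shrinkage removes them: they are at most \<open>e\<close>, hence at most
  the threshold, while the leading value stays above it.\<close>

lemma phaseI_run_rank_one:
  fixes X :: "real^'n^'m"
  assumes svd: "is_svd X U \<sigma> V" and X: "norm X = 1"
    and e: "0 \<le> e" "e \<le> 1 / 10" "1 - e\<^sup>2 / 2 \<le> \<sigma> 0"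
    and tol: "0 \<le> tol" "e < 1 - tol"
    and \<delta>: "0 < \<delta>" "e < 1 - \<delta>" "e \<le> \<delta> / sqrt (real (svd_size TYPE(real^'n^'m)))"
    and run: "phaseI_run \<delta> tol X s T Y"
  shows "s \<noteq> 0" "T \<noteq> 0" "\<exists>r>0. Y = r *\<^sub>R outer (U 0) (V 0)"
proof -
  let ?p = "svd_size TYPE(real^'n^'m)"
  note p = svd_size_pos[where 'm='m and 'n='n]
  have "e * e \<le> e * 1" using e by (intro mult_left_mono) auto
  then have e2: "e\<^sup>2 / 2 \<le> e / 2" by (simp add: power2_eq_square)
  obtain U1 \<sigma>1 V1 U2 \<sigma>2 V2 where svd1: "is_svd X U1 \<sigma>1 V1"
    and s: "s = card {i. i < ?p \<and> \<sigma>1 i > tol}" and T: "T = svd_trunc s U1 \<sigma>1 V1"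
    and svd2: "is_svd (T /\<^sub>R norm T) U2 \<sigma>2 V2"
    and Y: "Y = svd_shrink (\<delta> / sqrt (real s)) U2 \<sigma>2 V2"
    using run unfolding phaseI_run_def by blast
  note o = is_svdD[OF svd1]
  have e1: "e \<le> 1" using e by simp
  have lead1: "\<sigma>1 0 = \<sigma> 0" "outer (U1 0) (V1 0) = outer (U 0) (V 0)"
    using svd_leading_unique[OF svd svd1 svd_unit_tail(3)[OF svd X e(1) e1 e(3)]] e e2 by auto
  have big: "1 - e\<^sup>2 / 2 \<le> \<sigma>1 0" using e lead1 by simp
  have "0 \<in> {i. i < ?p \<and> \<sigma>1 i > tol}" using p big tol e2 e by auto
  then show s0: "s \<noteq> 0" unfolding s by (auto simp: card_eq_0_iff)
  have "s \<le> card {..<?p}" unfolding s by (intro card_mono) auto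
  then have sp: "s \<le> ?p" by simp
  define d where "d i = (if i < s then \<sigma>1 i else 0)" for i
  have Td: "T = diag_compose U1 d V1" by (simp add: T svd_trunc_def d_def[abs_def])
  have d0: "d 0 = \<sigma>1 0" using s0 by (simp add: d_def)
  have normT: "(norm T)\<^sup>2 = (\<Sum>i<?p. (d i)\<^sup>2)"
    unfolding Td by (rule norm_diag_compose[OF o(1,2)])
  also have "\<dots> \<le> (\<Sum>i<?p. (\<sigma>1 i)\<^sup>2)" by (intro sum_mono) (auto simp: d_def)
  also have "\<dots> = 1\<^sup>2" using norm_diag_compose[OF o(1,2), of \<sigma>1] X by (simp flip: o(5))
  finally have T1: "norm T \<le> 1" by (rule power2_le_imp_le) simp
  have "(d 0)\<^sup>2 \<le> (norm T)\<^sup>2"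
    unfolding normT using p by (intro member_le_sum) auto
  then have "d 0 \<le> norm T" by (rule power2_le_imp_le) simp
  then have T0: "0 < norm T" using d0 big e2 e by linarith
  then show "T \<noteq> 0" by auto
  \<comment> \<open>One SVD of the normalized truncation is explicit; the arbitrary second one is
    compared with it.\<close>
  have svdT: "is_svd (T /\<^sub>R norm T) U1 (\<lambda>i. d i / norm T) V1"
    unfolding is_svd_def Let_def
  proof (intro conjI allI impI)
    fix i j assume "i \<le> j \<and> j < ?p"
    then show "d j / norm T \<le> d i / norm T"
      using o(3)[of i] o(4)[of i j] T0 by (intro divide_right_mono) (auto simp: d_def)
  next
    fix i assume "i < ?p"
    then show "0 \<le> d i / norm T" using o(3)[of i] by (simp add: d_def)
  next
    show "T /\<^sub>R norm T = diag_compose U1 (\<lambda>i. d i / norm T) V1"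
      using diag_compose_scaleR[of U1 "inverse (norm T)" d V1]
      by (simp add: Td divide_inverse_commute)
  qed (use o in auto)
  have nT: "norm (T /\<^sub>R norm T) = 1" using T0 by simp
  \<comment> \<open>Since |T| <= 1, normalization does not decrease the leading value, so the tail
    bound holds again with the same \<open>e\<close>.\<close>
  have "d 0 \<le> d 0 / norm T" using T0 T1 d0 big e2 e by (simp add: le_divide_eq_1 field_simps mult_left_le)
  then have bigT: "1 - e\<^sup>2 / 2 \<le> d 0 / norm T" using d0 big by simp
  have lead2: "\<sigma>2 0 = d 0 / norm T" "outer (U2 0) (V2 0) = outer (U1 0) (V1 0)"
    using svd_leading_unique[OF svdT svd2 svd_unit_tail(3)[OF svdT nT e(1) e1 bigT]] bigT e e2
    by auto
  have big2: "1 - e\<^sup>2 / 2 \<le> \<sigma>2 0" using bigT lead2 by simp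
  let ?\<tau> = "\<delta> / sqrt (real s)"
  \<comment> \<open>Replacing \<open>s\<close> by its upper bound \<open>?p\<close> makes the lower
    bound on the threshold independent of the run.\<close>
  have "\<delta> / sqrt (real ?p) \<le> ?\<tau>"
    using sp s0 \<delta> by (intro divide_left_mono mult_pos_pos) auto
  then have "\<sigma>2 i \<le> ?\<tau>" if "0 < i" "i < ?p" for i
    using svd_unit_tail(3)[OF svd2 nT e(1) e1 big2 that] \<delta> by linarith
  then have "Y = max (\<sigma>2 0 - ?\<tau>) 0 *\<^sub>R outer (U2 0) (V2 0)"
    unfolding Y svd_shrink_def by (subst diag_compose_single) auto
  moreover have "?\<tau> \<le> \<delta> / 1"
    using s0 \<delta> by (intro divide_left_mono) auto
  then have "0 < max (\<sigma>2 0 - ?\<tau>) 0" using big2 e2 e \<delta> by simp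
  ultimately show "\<exists>r>0. Y = r *\<^sub>R outer (U 0) (V 0)"
    using lead1 lead2 by auto
qed

text \<open>Supplies the existence half of unique definedness; both decompositions come from
  \<open>svd_exists\<close>.\<close>

lemma phaseI_run_exists:
  fixes X :: "real^'n^'m"
  shows "\<exists>s T Y. phaseI_run \<delta> tol X s T Y"
proof -
  obtain U \<sigma> V where svd: "is_svd X U \<sigma> V" by (rule svd_exists)
  let ?s = "card {i. i < svd_size TYPE(real^'n^'m) \<and> \<sigma> i > tol}"
  let ?T = "svd_trunc ?s U \<sigma> V"
  obtain U' \<sigma>' V' where "is_svd (?T /\<^sub>R norm ?T) U' \<sigma>' V'" by (rule svd_exists)
  then have "phaseI_run \<delta> tol X ?s ?T (svd_shrink (\<delta> / sqrt (real ?s)) U' \<sigma>' V')"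
    unfolding phaseI_run_def using svd by (intro exI conjI) (assumption | rule refl)+
  then show ?thesis by blast
qed

lemma normalized_orth_proj_scaleR:
  fixes M :: "'a::euclidean_space set"
  assumes "subspace M" "0 < r"
  shows "orth_proj M (r *\<^sub>R X) /\<^sub>R norm (orth_proj M (r *\<^sub>R X)) =
    orth_proj M X /\<^sub>R norm (orth_proj M X)"
  using assms by (simp add: orth_proj_scaleR)

text \<open>Every Phase I run and every rank-1 truncation yields a positive multiple of
  \<open>L\<close>. Normalization cancels the factor, so both steps return \<open>N\<close> for
  every choice of SVDs.\<close>

lemma phase_steps_near_rank_one:
  fixes M :: "(real^'n^'m) set" and u :: "real^'m" and v :: "real^'n"
  assumes M: "subspace M" and uv: "norm u = 1" "norm v = 1" and XsM: "outer u v \<in> M"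
    and c: "0 \<le> c" "c < 1"
    and angle: "\<And>A x y. A \<in> tangent_sphere M (outer u v) \<Longrightarrow>
        \<bar>A \<bullet> (outer u y + outer x v)\<bar> \<le> c * norm A * norm (outer u y + outer x v)"
    and X: "X \<in> unit_sphere M" and e_def: "e = norm (X - outer u v)"
    and e: "e \<le> 1 / 10" "e \<le> (1 - c) / 6"
    and tol: "0 \<le> tol" "e < 1 - tol"
    and \<delta>: "0 < \<delta>" "e < 1 - \<delta>" "e \<le> \<delta> / sqrt (real (svd_size TYPE(real^'n^'m)))"
  shows "phaseI_well_defined M \<delta> tol X" "phaseII_well_defined M 1 X"
    and "phaseI_step M \<delta> tol X = phaseII_step M 1 X"
    and "phaseI_step M \<delta> tol X \<in> unit_sphere M"
    and "norm (phaseI_step M \<delta> tol X - outer u v) \<le> c * e"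
proof -
  have X': "X \<in> M" "norm X = 1" using X by (auto simp: unit_sphere_def)
  obtain U \<sigma> V where svd: "is_svd X U \<sigma> V" by (rule svd_exists)
  define L where "L = outer (U 0) (V 0)"
  define N where "N = orth_proj M L /\<^sub>R norm (orth_proj M L)"
  have e0: "0 \<le> e" by (simp add: e_def)
  have e1: "e \<le> 1" using e by simp
  have "e * e \<le> e * 1" using e1 e0 by (intro mult_left_mono) auto
  then have e2: "e\<^sup>2 / 2 \<le> e / 2" by (simp add: power2_eq_square)
  have big: "1 - e\<^sup>2 / 2 \<le> \<sigma> 0"
    using svd_near_rank_one[OF svd X'(2) uv] by (simp add: e_def)
  then have s0: "0 < \<sigma> 0" using e2 e by linarith
  note contr = leading_projection_contracts[OF M uv XsM c angle X' e_def e svd, folded L_def]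
  have L0: "orth_proj M L \<noteq> 0"
    using contr(1) by (simp add: orth_proj_scaleR[OF M])
  have bound: "norm (N - outer u v) \<le> c * e"
    using contr(2) unfolding normalized_orth_proj_scaleR[OF M s0] N_def .
  have pos: "orth_proj M (r *\<^sub>R L) \<noteq> 0 \<and>
      orth_proj M (r *\<^sub>R L) /\<^sub>R norm (orth_proj M (r *\<^sub>R L)) = N" if "0 < r" for r
    using that L0 normalized_orth_proj_scaleR[OF M that, of L] by (simp add: orth_proj_scaleR[OF M] N_def)
  have run: "s \<noteq> 0 \<and> T \<noteq> 0 \<and> (\<exists>r>0. Y = r *\<^sub>R L)" if "phaseI_run \<delta> tol X s T Y" for s T Y
    using phaseI_run_rank_one[OF svd X'(2) e0 e(1) big tol \<delta> that] by (simp add: L_def)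
  have res: "phaseI_result M \<delta> tol X Z \<longleftrightarrow> Z = N" for Z
    unfolding phaseI_result_def using run pos phaseI_run_exists[of \<delta> tol X] by metis
  show "phaseI_well_defined M \<delta> tol X"
    unfolding phaseI_well_defined_def res using run pos by blast
  have step: "phaseI_step M \<delta> tol X = N" by (simp add: phaseI_step_def res)
  have trunc: "svd_trunc 1 U' \<sigma>' V' = \<sigma> 0 *\<^sub>R L" if "is_svd X U' \<sigma>' V'" for U' \<sigma>' V'
    using svd_leading_unique[OF svd that svd_unit_tail(3)[OF svd X'(2) e0 e1 big]] e0 e e2 big
    unfolding svd_trunc_1 L_def by simp
  have res2: "phaseII_result M 1 X Z \<longleftrightarrow> Z = N" for Z
    unfolding phaseII_result_def using trunc pos[OF s0] svd by metis
  show "phaseII_well_defined M 1 X"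
    unfolding phaseII_well_defined_def res2 using trunc pos[OF s0] by auto
  have "phaseII_step M 1 X = N" unfolding phaseII_step_def res2 by simp
  then show "phaseI_step M \<delta> tol X = phaseII_step M 1 X" using step by simp
  show "phaseI_step M \<delta> tol X \<in> unit_sphere M"
    unfolding step N_def unit_sphere_def using L0 M by (simp add: orth_proj_in subspace_scale)
  show "norm (phaseI_step M \<delta> tol X - outer u v) \<le> c * e" using step bound by simp
qed

section \<open>Iteration, tangent spaces and the conclusion\<close>

text \<open>The factor \<open>q\<close> below 1 keeps the iterates in the ball, so the local
  estimate stays applicable; the bound by \<open>q ^ k\<close> is carried through the same
  induction.\<close>

lemma iterates_contract:
  fixes f :: "'a::real_normed_vector \<Rightarrow> 'a"
  assumes q: "0 \<le> q" "q < 1"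
    and step: "\<And>y. y \<in> S \<Longrightarrow> norm (y - z) < \<epsilon> \<Longrightarrow> f y \<in> S \<and> norm (f y - z) \<le> q * norm (y - z)"
    and x: "x \<in> S" "norm (x - z) < \<epsilon>"
  shows "(f ^^ k) x \<in> S" "norm ((f ^^ k) x - z) < \<epsilon>" "(\<lambda>k. (f ^^ k) x) \<longlonglongrightarrow> z"
proof -
  have *: "(f ^^ k) x \<in> S \<and> norm ((f ^^ k) x - z) < \<epsilon> \<and>
      norm ((f ^^ k) x - z) \<le> q ^ k * norm (x - z)" for k
  proof (induction k)
    case (Suc k)
    then have "f ((f ^^ k) x) \<in> S" and le: "norm (f ((f ^^ k) x) - z) \<le> q * norm ((f ^^ k) x - z)"
      using step by blast+
    moreover have "q * norm ((f ^^ k) x - z) \<le> 1 * norm ((f ^^ k) x - z)"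
      using q by (intro mult_right_mono) auto
    moreover have "q * norm ((f ^^ k) x - z) \<le> q * (q ^ k * norm (x - z))"
      using Suc q by (intro mult_left_mono) auto
    ultimately show ?case using Suc by (auto simp: mult.assoc)
  qed (use x in auto)
  then show "(f ^^ k) x \<in> S" "norm ((f ^^ k) x - z) < \<epsilon>" by blast+
  have "(\<lambda>k. q ^ k * norm (x - z)) \<longlonglongrightarrow> 0"
    using q by (intro tendsto_mult_left_zero LIMSEQ_power_zero) auto
  then have "(\<lambda>k. (f ^^ k) x - z) \<longlonglongrightarrow> 0"
    by (rule Lim_null_comparison[rotated]) (intro always_eventually allI, use * in blast)
  then show "(\<lambda>k. (f ^^ k) x) \<longlonglongrightarrow> z" by (rule LIM_zero_cancel)
qed

text \<open>Agreement is assumed along the orbit of \<open>f\<close> only, since the two phases are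
  compared only near the limit.\<close>

lemma funpow_eq_along_iterates:
  assumes "\<And>k. f ((f ^^ k) x) = g ((f ^^ k) x)"
  shows "(f ^^ k) x = (g ^^ k) x"
proof (induction k)
  case (Suc k)
  then show ?case using assms[of k] by simp
qed simp

lemma subspace_tangent_sphere:
  assumes "subspace M"
  shows "subspace (tangent_sphere M X)"
  unfolding tangent_sphere_def using assms by (intro subspace_inter subspace_orthogonal_comp)

lemma subspace_outer_sums: "subspace {outer u y + outer x v | x y. True}"
proof (rule subspaceI)
  have "0 = outer u 0 + outer 0 v" by (simp add: outer.zero_left outer.zero_right)
  then show "0 \<in> {outer u y + outer x v | x y. True}" by blast
next
  fix A B assume "A \<in> {outer u y + outer x v | x y. True}" "B \<in> {outer u y + outer x v | x y. True}"
  then obtain x y x' y' where "A = outer u y + outer x v" "B = outer u y' + outer x' v" by auto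
  then have "A + B = outer u (y + y') + outer (x + x') v"
    by (simp add: outer.add_left outer.add_right)
  then show "A + B \<in> {outer u y + outer x v | x y. True}" by blast
next
  fix c A assume "A \<in> {outer u y + outer x v | x y. True}"
  then obtain x y where "A = outer u y + outer x v" by auto
  then have "c *\<^sub>R A = outer u (c *\<^sub>R y) + outer (c *\<^sub>R x) v"
    by (simp add: outer.scaleR_left outer.scaleR_right scaleR_add_right)
  then show "c *\<^sub>R A \<in> {outer u y + outer x v | x y. True}" by blast
qed

theorem corollary5:
  fixes M :: "(real^'n^'m) set" and Xs :: "real^'n^'m"
  assumes "subspace M"
    and "Xs \<in> unit_sphere M"
    and "rank Xs = 1"
    and "tangent_rank_one Xs \<inter> tangent_sphere M Xs = {0}"
  shows "\<exists>\<theta>. 0 < \<theta> \<and> \<theta> \<le> pi / 2 \<and>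
     is_subspace_angle \<theta> (tangent_sphere M Xs) (tangent_rank_one Xs) \<and>
     (\<exists>C. \<forall>\<delta> tol. 0 < \<delta> \<and> \<delta> < 1 \<and> 0 \<le> tol \<and> tol < 1 \<longrightarrow>
       (\<exists>\<epsilon>>0.
          (\<forall>X \<in> unit_sphere M. norm (X - Xs) < \<epsilon> \<longrightarrow>
             phaseI_well_defined M \<delta> tol X \<and>
             (X \<noteq> Xs \<longrightarrow>
                norm (phaseI_step M \<delta> tol X - Xs) / norm (X - Xs)
                  \<le> cos \<theta> + C * (norm (X - Xs))\<^sup>2) \<and>
             phaseII_well_defined M 1 X \<and>
             phaseI_step M \<delta> tol X = phaseII_step M 1 X) \<and>
          (\<exists>q. 0 \<le> q \<and> q < 1 \<and>
             (\<forall>X \<in> unit_sphere M. norm (X - Xs) < \<epsilon> \<longrightarrow>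
                (\<forall>k. phaseI_well_defined M \<delta> tol ((phaseI_step M \<delta> tol ^^ k) X) \<and>
                     norm ((phaseI_step M \<delta> tol ^^ Suc k) X - Xs)
                       \<le> q * norm ((phaseI_step M \<delta> tol ^^ k) X - Xs) \<and>
                     (phaseI_step M \<delta> tol ^^ k) X = (phaseII_step M 1 ^^ k) X) \<and>
                (\<lambda>k. (phaseI_step M \<delta> tol ^^ k) X) \<longlonglongrightarrow> Xs))))"
proof -
  \<comment> \<open>Membership of 0 makes the tangent set nonempty, which yields the vectors
    \<open>u\<close> and \<open>v\<close>; norm 1 then forces \<open>\<rho> = 1\<close>.\<close>
  have "0 \<in> tangent_rank_one Xs" using assms(4) by blast
  then obtain u v \<rho> where uv: "norm u = 1" "norm v = 1" and "\<rho> > 0" "Xs = \<rho> *\<^sub>R outer u v"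
    unfolding tangent_rank_one_def by auto
  then have Xs: "Xs = outer u v"
    using assms(2) by (simp add: unit_sphere_def)
  have tan: "tangent_rank_one Xs = {outer u y + outer x v | x y. True}"
    using tangent_rank_one_eq[OF uv, of 1] Xs by simp
  have XsM: "outer u v \<in> M" using assms(2) Xs by (simp add: unit_sphere_def)
  have sub: "subspace (tangent_rank_one Xs)" unfolding tan by (rule subspace_outer_sums)
  have triv: "tangent_sphere M Xs \<inter> tangent_rank_one Xs = {0}"
    using assms(4) by (simp add: Int_commute)
  obtain \<theta> where \<theta>: "0 < \<theta>" "\<theta> \<le> pi / 2"
      "is_subspace_angle \<theta> (tangent_sphere M Xs) (tangent_rank_one Xs)"
    and cs: "\<And>A Y. A \<in> tangent_sphere M Xs \<Longrightarrow> Y \<in> tangent_rank_one Xs \<Longrightarrow>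
      \<bar>A \<bullet> Y\<bar> \<le> cos \<theta> * norm A * norm Y"
    using subspace_angle_exists[OF subspace_tangent_sphere[OF assms(1)] sub triv] by blast
  let ?c = "cos \<theta>"
  have c: "0 \<le> ?c" "?c < 1"
    using \<theta> cos_ge_zero[of \<theta>] cos_monotone_0_pi[of 0 \<theta>] by auto
  have angle: "\<bar>A \<bullet> (outer u y + outer x v)\<bar> \<le> ?c * norm A * norm (outer u y + outer x v)"
    if "A \<in> tangent_sphere M (outer u v)" for A x y
    using cs[of A "outer u y + outer x v"] that tan Xs by blast
  have near: "\<exists>\<epsilon>>0. \<forall>X \<in> unit_sphere M. norm (X - Xs) < \<epsilon> \<longrightarrow>
      phaseI_well_defined M \<delta> tol X \<and> phaseII_well_defined M 1 X \<and>
      phaseI_step M \<delta> tol X = phaseII_step M 1 X \<and> phaseI_step M \<delta> tol X \<in> unit_sphere M \<and>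
      norm (phaseI_step M \<delta> tol X - Xs) \<le> ?c * norm (X - Xs)"
    if "0 < \<delta>" "\<delta> < 1" "0 \<le> tol" "tol < 1" for \<delta> tol
  proof -
    \<comment> \<open>The first two bounds serve the contraction, \<open>1 - tol\<close> keeps the
      leading value above the cutoff, and the last two place the threshold between the tail and the
      leading value.\<close>
    let ?\<epsilon> = "Min {1 / 10, (1 - ?c) / 6, 1 - tol, 1 - \<delta>, \<delta> / sqrt (real (svd_size TYPE(real^'n^'m)))}"
    have "0 < ?\<epsilon>" using that c svd_size_pos[where 'm='m and 'n='n] by simp
    then show ?thesis
      using phase_steps_near_rank_one[OF assms(1) uv XsM c angle _ refl, of _ tol \<delta>] that
      unfolding Xs by (intro exI[of _ ?\<epsilon>]) (simp add: less_imp_le)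
  qed
  show ?thesis
  \<comment> \<open>The error constant is 0 for all \<open>\<delta>\<close> and \<open>tol\<close>;
    only \<open>\<epsilon>\<close> depends on them.\<close>
  proof (rule exI[of _ \<theta>], intro conjI \<theta>, rule exI[of _ 0], intro allI impI)
    fix \<delta> tol :: real
    assume *: "0 < \<delta> \<and> \<delta> < 1 \<and> 0 \<le> tol \<and> tol < 1"
    let ?f = "phaseI_step M \<delta> tol"
    obtain \<epsilon> where \<epsilon>: "\<epsilon> > 0" and near: "\<And>X. X \<in> unit_sphere M \<Longrightarrow> norm (X - Xs) < \<epsilon> \<Longrightarrow>
        phaseI_well_defined M \<delta> tol X \<and> phaseII_well_defined M 1 X \<and>
        ?f X = phaseII_step M 1 X \<and> ?f X \<in> unit_sphere M \<and>
        norm (?f X - Xs) \<le> ?c * norm (X - Xs)"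
      using near * by metis
    show "\<exists>\<epsilon>>0.
          (\<forall>X \<in> unit_sphere M. norm (X - Xs) < \<epsilon> \<longrightarrow>
             phaseI_well_defined M \<delta> tol X \<and>
             (X \<noteq> Xs \<longrightarrow> norm (?f X - Xs) / norm (X - Xs) \<le> ?c + 0 * (norm (X - Xs))\<^sup>2) \<and>
             phaseII_well_defined M 1 X \<and> ?f X = phaseII_step M 1 X) \<and>
          (\<exists>q. 0 \<le> q \<and> q < 1 \<and>
             (\<forall>X \<in> unit_sphere M. norm (X - Xs) < \<epsilon> \<longrightarrow>
                (\<forall>k. phaseI_well_defined M \<delta> tol ((?f ^^ k) X) \<and>
                     norm ((?f ^^ Suc k) X - Xs) \<le> q * norm ((?f ^^ k) X - Xs) \<and>
                     (?f ^^ k) X = (phaseII_step M 1 ^^ k) X) \<and>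
                (\<lambda>k. (?f ^^ k) X) \<longlonglongrightarrow> Xs))"
    \<comment> \<open>The linear rate is \<open>cos \<theta>\<close>, which is below 1 because the
      angle is positive.\<close>
    proof (rule exI[of _ \<epsilon>], intro exI[of _ ?c] conjI \<epsilon> c ballI impI allI)
      fix X k assume X: "X \<in> unit_sphere M" "norm (X - Xs) < \<epsilon>"
      note nearX = near[OF X]
      show "phaseI_well_defined M \<delta> tol X" "phaseII_well_defined M 1 X" "?f X = phaseII_step M 1 X"
        using nearX by blast+
      show "norm (?f X - Xs) / norm (X - Xs) \<le> ?c + 0 * (norm (X - Xs))\<^sup>2" if "X \<noteq> Xs"
      proof -
        have "norm (?f X - Xs) \<le> ?c * norm (X - Xs)" using nearX by blast
        then show ?thesis using that by (simp add: divide_le_eq)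
      qed
      have step: "Y \<in> unit_sphere M \<Longrightarrow> norm (Y - Xs) < \<epsilon> \<Longrightarrow>
          ?f Y \<in> unit_sphere M \<and> norm (?f Y - Xs) \<le> ?c * norm (Y - Xs)" for Y
        using near by blast
      note iter = iterates_contract[OF c step X]
      have near_iter: "phaseI_well_defined M \<delta> tol ((?f ^^ j) X) \<and>
          ?f ((?f ^^ j) X) = phaseII_step M 1 ((?f ^^ j) X) \<and>
          norm (?f ((?f ^^ j) X) - Xs) \<le> ?c * norm ((?f ^^ j) X - Xs)" for j
        using near[OF iter(1,2)] by blast
      show "phaseI_well_defined M \<delta> tol ((?f ^^ k) X)"
        "norm ((?f ^^ Suc k) X - Xs) \<le> ?c * norm ((?f ^^ k) X - Xs)"
        unfolding funpow.simps comp_apply using near_iter[of k] by blast+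
      show "(?f ^^ k) X = (phaseII_step M 1 ^^ k) X"
        by (rule funpow_eq_along_iterates) (use near_iter in blast)
      show "(\<lambda>k. (?f ^^ k) X) \<longlonglongrightarrow> Xs" by (rule iter(3))
    qed
  qed
qed

end
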